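(* For every cake-division instance with $n$ agents whose social graph is a 2-Star, there exists a discrete protocol in the Robertson–Webb query model that finds a locally envy-free allocation using at most $O(n^2)$ cut queries and $O(n^3)$ evaluation queries.
   Context: The cake is $[0,1]$. Each agent $a_i$ has a valuation $v_i$ on finite unions of subintervals of $[0,1]$ that is non-negative, additive on disjoint pieces, non-atomic (for any $[x,y]$ and $\lambda\in[0,1]$ there is $y'$ with $v_i(x,y')=\lambda v_i(x,y)$), and normalized ($v_i(0,1)=1$). An allocation is a collection $\{A_1,\dots,A_n\}$ of pairwise disjoint pieces (each a finite union of intervals) whose union is $[0,1]$, with $A_i$ given to $a_i$. Given an undirected social graph $G$ on the agents, an allocation is locally envy-free if $v_i(A_i)\ge v_i(A_j)$ for every edge $(i,j)$ of $G$. In the Robertson–Webb query model the protocol accesses valuations only through cut queries $\texttt{cut}_i(x,\tau)$ (returns $y$ with $v_i(x,y)=\tau$) and evaluation queries $\texttt{eval}_i(x,y)$ (returns $v_i(x,y)$). A 2-Star is a rooted tree of depth at most two (every vertex at distance at most two from the root) in which every non-root vertex is adjacent to at most two vertices. *)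

theory Defs
  imports Main "HOL.Real"
begin

text \<open>Agents are 0,...,n-1.  A valuation profile assigns to agent i and an
interval [x,y] with 0 <= x <= y <= 1 the value v i x y; values of finite unions
of intervals are obtained by additivity.\<close>

definition valuation :: "(real \<Rightarrow> real \<Rightarrow> real) \<Rightarrow> bool" where
  "valuation u \<longleftrightarrow>
     (\<forall>x y. 0 \<le> x \<longrightarrow> x \<le> y \<longrightarrow> y \<le> 1 \<longrightarrow> 0 \<le> u x y) \<and>
     (\<forall>x y z. 0 \<le> x \<longrightarrow> x \<le> y \<longrightarrow> y \<le> z \<longrightarrow> z \<le> 1 \<longrightarrow> u x z = u x y + u y z) \<and>
     (\<forall>x y lam. 0 \<le> x \<longrightarrow> x \<le> y \<longrightarrow> y \<le> 1 \<longrightarrow> 0 \<le> lam \<longrightarrow> lam \<le> 1 \<longrightarrow>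
        (\<exists>y'. x \<le> y' \<and> y' \<le> y \<and> u x y' = lam * u x y)) \<and>
     u 0 1 = 1"

definition valuation_profile :: "nat \<Rightarrow> (nat \<Rightarrow> real \<Rightarrow> real \<Rightarrow> real) \<Rightarrow> bool" where
  "valuation_profile n v \<longleftrightarrow> (\<forall>i<n. valuation (v i))"

text \<open>A piece is a finite union of intervals, given as a list of intervals [a,b].\<close>
type_synonym piece = "(real \<times> real) list"
type_synonym allocation = "nat \<Rightarrow> piece"

definition piece_value :: "(real \<Rightarrow> real \<Rightarrow> real) \<Rightarrow> piece \<Rightarrow> real" where
  "piece_value u P = sum_list (map (\<lambda>(a,b). u a b) P)"

text \<open>Allocation: intervals lie in [0,1], distinct intervals (of the same or of
different pieces) have disjoint interiors (pieces are disjoint up to finitely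
many points, which carry no value by non-atomicity), and together they cover [0,1].\<close>
definition is_allocation :: "nat \<Rightarrow> allocation \<Rightarrow> bool" where
  "is_allocation n A \<longleftrightarrow>
     (\<forall>i<n. \<forall>(a,b)\<in>set (A i). 0 \<le> a \<and> a \<le> b \<and> b \<le> 1) \<and>
     (\<forall>i<n. \<forall>j<n. \<forall>k<length (A i). \<forall>l<length (A j). (i,k) \<noteq> (j,l) \<longrightarrow>
        {fst (A i ! k)<..<snd (A i ! k)} \<inter> {fst (A j ! l)<..<snd (A j ! l)} = {}) \<and>
     {0..1} \<subseteq> (\<Union>i<n. \<Union>(a,b)\<in>set (A i). {a..b})"

definition locally_envy_free ::
  "nat \<Rightarrow> (nat \<Rightarrow> nat \<Rightarrow> bool) \<Rightarrow> (nat \<Rightarrow> real \<Rightarrow> real \<Rightarrow> real) \<Rightarrow> allocation \<Rightarrow> bool" where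
  "locally_envy_free n E v A \<longleftrightarrow> is_allocation n A \<and>
     (\<forall>i<n. \<forall>j<n. E i j \<longrightarrow> piece_value (v i) (A i) \<ge> piece_value (v i) (A j))"

text \<open>Social graph: symmetric irreflexive edge relation on {0..<n}.
A 2-Star with root r: a tree (connected, n-1 edges) in which every vertex is
at distance at most 2 from r and every non-root vertex has degree at most 2.\<close>
definition two_star :: "nat \<Rightarrow> (nat \<Rightarrow> nat \<Rightarrow> bool) \<Rightarrow> nat \<Rightarrow> bool" where
  "two_star n E r \<longleftrightarrow>
     r < n \<and>
     (\<forall>u w. E u w \<longrightarrow> u < n \<and> w < n \<and> u \<noteq> w \<and> E w u) \<and>
     (\<forall>w<n. w = r \<or> E r w \<or> (\<exists>u. E r u \<and> E u w)) \<and>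
     card {(u,w). u < w \<and> w < n \<and> E u w} = n - 1 \<and>
     (\<forall>w<n. w \<noteq> r \<longrightarrow> card {u. u < n \<and> E w u} \<le> 2)"

text \<open>Robertson--Webb protocols as query trees.  Cut i x t k asks cut_i(x,t) and
continues with k applied to the answer; Eval i x y k asks eval_i(x,y).
Between queries arbitrary computation is allowed (the continuations are
arbitrary functions of the answers).\<close>
datatype protocol =
    Cut nat real real "real \<Rightarrow> protocol"
  | Eval nat real real "real \<Rightarrow> protocol"
  | Output allocation

text \<open>rw_solves n v Q P c e: on valuation profile v, every execution of P
(for every admissible answer to each cut query) is well-defined, uses at most
c cut queries and e evaluation queries, and outputs an allocation satisfying Q.\<close>
inductive rw_solves ::
  "nat \<Rightarrow> (nat \<Rightarrow> real \<Rightarrow> real \<Rightarrow> real) \<Rightarrow> (allocation \<Rightarrow> bool) \<Rightarrow> protocol \<Rightarrow> nat \<Rightarrow> nat \<Rightarrow> bool"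
  for n v Q where
  out: "Q A \<Longrightarrow> rw_solves n v Q (Output A) c e"
| cut: "\<lbrakk> i < n; 0 \<le> x; x \<le> 1;
          \<exists>y. x \<le> y \<and> y \<le> 1 \<and> v i x y = t;
          \<forall>y. x \<le> y \<and> y \<le> 1 \<and> v i x y = t \<longrightarrow> rw_solves n v Q (k y) c e \<rbrakk>
        \<Longrightarrow> rw_solves n v Q (Cut i x t k) (Suc c) e"
| eval: "\<lbrakk> i < n; 0 \<le> x; x \<le> y; y \<le> 1; rw_solves n v Q (k (v i x y)) c e \<rbrakk>
        \<Longrightarrow> rw_solves n v Q (Eval i x y k) c (Suc e)"

end

theory Submission
  imports Defs
begin

text \<open>The root repeatedly cuts the residue into \<open>n\<close> pieces of equal value to it. Each neighbour
with a child takes its two favourite remaining pieces and trims the better one down to the value of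
the other; the trimmings form the next residue, at most half the old one in the eyes of the root.
The neighbour is indifferent between its two pieces, so its child may choose, unless the neighbour
takes the trimmed piece, in which case the root gains an advantage over it. After \<open>2 n\<close> rounds one
can revise a single earlier choice so that the root's advantage over some neighbour exceeds its
value of the whole residue, while the child of that neighbour still does not envy. This pair then
settles the residue by cut and choose.\<close>

text \<open>Who keeps \<open>X\<close> or \<open>Y\<close> influences no query of the rounds, so it
  can be settled in hindsight. The obstacle is the root: if every child simply takes its favourite,
  a neighbour may be left with the untrimmed piece each time, and the root gains nothing over it.
  Reversing one such choice costs the child something, which its gain in another round must cover.
  So one neighbour with a large trimming in two rounds is wanted. Fewer than n/2 agents are
  neighbours with a child, hence n rounds provide it by pigeonhole. The other n rounds shrink the
  residue by a factor of at least 2^n, more than what is lost in passing from all trimmings of a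
  round to the largest one. No query tree for the whole protocol is written down. The argument is a
  game about how many cuts suffice from a given state of knowledge, and the tree is extracted from
  the winning statement.\<close>

section \<open>Additive interval functions and values of pieces\<close>

text \<open>An identity of piece values that holds for all such functions records how pieces were
  cut, independently of any profile. Indicators of points are instances too, which later recovers
  disjointness and covering.\<close>

definition additive :: "(real \<Rightarrow> real \<Rightarrow> real) \<Rightarrow> bool" where
  "additive f \<longleftrightarrow> (\<forall>a b c. 0 \<le> a \<longrightarrow> a \<le> b \<longrightarrow> b \<le> c \<longrightarrow> c \<le> 1 \<longrightarrow> f a c = f a b + f b c)"

text \<open>Endpoints in \<open>D\<close> make the value of a piece known: by additivity it is a sum
  of differences of values of intervals from 0 to points of \<open>D\<close>.\<close>

definition piece_in :: "real set \<Rightarrow> piece \<Rightarrow> bool" where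
  "piece_in D P \<longleftrightarrow> (\<forall>(a,b)\<in>set P. a \<in> D \<and> b \<in> D \<and> a \<le> b)"

lemma additiveD: "additive f \<Longrightarrow> 0 \<le> a \<Longrightarrow> a \<le> b \<Longrightarrow> b \<le> c \<Longrightarrow> c \<le> 1 \<Longrightarrow> f a c = f a b + f b c"
  unfolding additive_def by blast

lemma valuation_additive: "valuation u \<Longrightarrow> additive u"
  unfolding additive_def valuation_def by blast

lemma additive_refl: "additive f \<Longrightarrow> 0 \<le> a \<Longrightarrow> a \<le> 1 \<Longrightarrow> f a a = 0"
  using additiveD[of f a a a] by simp

lemma additive_diff: "additive f \<Longrightarrow> 0 \<le> a \<Longrightarrow> a \<le> b \<Longrightarrow> b \<le> 1 \<Longrightarrow> f a b = f 0 b - f 0 a"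
  using additiveD[of f 0 a b] by simp

lemma valuation_nonneg: "valuation u \<Longrightarrow> 0 \<le> x \<Longrightarrow> x \<le> y \<Longrightarrow> y \<le> 1 \<Longrightarrow> 0 \<le> u x y"
  unfolding valuation_def by blast

lemma valuation_cut_exists:
  assumes "valuation u" "0 \<le> x" "x \<le> y" "y \<le> 1" "0 \<le> t" "t \<le> u x y"
  shows "\<exists>z. x \<le> z \<and> z \<le> y \<and> u x z = t"
proof (cases "u x y = 0")
  case True
  then have "u x x = t"
    using additive_refl[OF valuation_additive[OF assms(1)]] assms by simp
  then show ?thesis using assms by auto
next
  case False
  then have "0 < u x y" using assms by simp
  then have "0 \<le> t / u x y" "t / u x y \<le> 1" using assms by auto
  moreover have "\<forall>x y lam. 0 \<le> x \<longrightarrow> x \<le> y \<longrightarrow> y \<le> 1 \<longrightarrow> 0 \<le> lam \<longrightarrow> lam \<le> 1 \<longrightarrow>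
      (\<exists>y'. x \<le> y' \<and> y' \<le> y \<and> u x y' = lam * u x y)"
    using assms(1) unfolding valuation_def by blast
  ultimately obtain z where "x \<le> z" "z \<le> y" "u x z = t / u x y * u x y"
    using assms(2-4) by blast
  then show ?thesis using False by auto
qed

lemma piece_value_Nil [simp]: "piece_value f [] = 0"
  by (simp add: piece_value_def)

lemma piece_value_Cons [simp]: "piece_value f ((a,b) # P) = f a b + piece_value f P"
  by (simp add: piece_value_def)

lemma piece_value_append [simp]: "piece_value f (P @ Q) = piece_value f P + piece_value f Q"
  by (simp add: piece_value_def)

lemma piece_value_concat_map:
  "distinct xs \<Longrightarrow> piece_value f (concat (map g xs)) = (\<Sum>x\<in>set xs. piece_value f (g x))"
  by (induction xs) auto

lemma piece_in_Nil [simp]: "piece_in D []"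
  by (simp add: piece_in_def)

lemma piece_in_Cons [simp]: "piece_in D ((a,b) # P) \<longleftrightarrow> a \<in> D \<and> b \<in> D \<and> a \<le> b \<and> piece_in D P"
  by (auto simp: piece_in_def)

lemma piece_in_append [simp]: "piece_in D (P @ Q) \<longleftrightarrow> piece_in D P \<and> piece_in D Q"
  by (auto simp: piece_in_def)

lemma piece_in_concat_map [simp]: "piece_in D (concat (map g xs)) \<longleftrightarrow> (\<forall>x\<in>set xs. piece_in D (g x))"
  by (induction xs) auto

lemma piece_in_mono: "piece_in D P \<Longrightarrow> D \<subseteq> D' \<Longrightarrow> piece_in D' P"
  by (auto simp: piece_in_def)

lemma piece_value_nonneg:
  assumes "valuation u" "D \<subseteq> {0..1}" "piece_in D P"
  shows "0 \<le> piece_value u P"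
  using assms(3)
proof (induction P)
  case (Cons p P)
  obtain a b where p: "p = (a,b)" by force
  have "0 \<le> u a b" using Cons.prems assms(2) p by (rule_tac valuation_nonneg[OF assms(1)]) auto
  then show ?case using Cons p by simp
qed simp

section \<open>Query trees and the game on partial knowledge\<close>

lemma rw_solves_mono:
  "rw_solves n v Q P c e \<Longrightarrow> c \<le> c' \<Longrightarrow> e \<le> e' \<Longrightarrow> rw_solves n v Q P c' e'"
proof (induction arbitrary: c' e' rule: rw_solves.induct)
  case (out A c e)
  then show ?case by (simp add: rw_solves.out)
next
  case (cut i x t k c e)
  then obtain d where "c' = Suc d" "c \<le> d" by (cases c') auto
  then show ?case using cut by (auto intro!: rw_solves.cut)
next
  case (eval i x y k c e)
  then obtain d where "e' = Suc d" "e \<le> d" by (cases e') auto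
  then show ?case using eval by (auto intro!: rw_solves.eval)
qed

text \<open>The answers are accumulated in \<open>w\<close>, so that the continuation can depend on
  all of them together.\<close>

primrec ask :: "nat \<Rightarrow> real \<Rightarrow> (nat \<Rightarrow> real) \<Rightarrow> ((nat \<Rightarrow> real) \<Rightarrow> protocol) \<Rightarrow> protocol" where
  "ask 0 z w k = k w"
| "ask (Suc m) z w k = Eval m 0 z (\<lambda>a. ask m z (w(m := a)) k)"

lemma rw_solves_ask:
  assumes "0 \<le> z" "z \<le> 1"
  shows "m \<le> n \<Longrightarrow> rw_solves n v Q (k (\<lambda>j. if j < m then v j 0 z else w j)) c e
    \<Longrightarrow> rw_solves n v Q (ask m z w k) c (m + e)"
proof (induction m arbitrary: w)
  case (Suc m)
  have "(\<lambda>j. if j < Suc m then v j 0 z else w j) =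
      (\<lambda>j. if j < m then v j 0 z else (w(m := v m 0 z)) j)"
    by (auto simp: less_Suc_eq)
  then have "rw_solves n v Q (ask m z (w(m := v m 0 z)) k) c (m + e)"
    using Suc by simp
  then show ?case using Suc.prems assms by (auto intro!: rw_solves.eval)
qed simp

text \<open>The knowledge of a protocol is represented by a set \<open>D\<close> of points up to which every agent has
been evaluated, together with any profile \<open>v\<close> that matches the answers. Every cut is followed by
one evaluation per agent, so that no further evaluations are needed.\<close>

locale rw_game =
  fixes n :: nat and G :: "(nat \<Rightarrow> real \<Rightarrow> real \<Rightarrow> real) \<Rightarrow> allocation \<Rightarrow> bool"
begin

definition agree :: "real set \<Rightarrow> (nat \<Rightarrow> real \<Rightarrow> real \<Rightarrow> real) \<Rightarrow> (nat \<Rightarrow> real \<Rightarrow> real \<Rightarrow> real) \<Rightarrow> bool" where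
  "agree D v v' \<longleftrightarrow> (\<forall>i<n. \<forall>x\<in>D. v i 0 x = v' i 0 x)"

text \<open>\<open>v\<close> merely represents the knowledge: a single tree \<open>P\<close> has to
  serve every profile agreeing with it on \<open>D\<close>, although the goal \<open>G v'\<close>
  varies with the profile. Counting cuts suffices, as each is charged \<open>n\<close>
  evaluations.\<close>

definition win :: "nat \<Rightarrow> real set \<Rightarrow> (nat \<Rightarrow> real \<Rightarrow> real \<Rightarrow> real) \<Rightarrow> bool" where
  "win c D v \<longleftrightarrow> (\<exists>P. \<forall>v'. valuation_profile n v' \<longrightarrow> agree D v v' \<longrightarrow> rw_solves n v' (G v') P c (n * c))"

definition extends where
  "extends D v D' v' \<longleftrightarrow> valuation_profile n v' \<and> D \<subseteq> D' \<and> D' \<subseteq> {0..1} \<and> agree D v v'"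

text \<open>Continuation form: \<open>k\<close> cuts lead to a position with \<open>\<Psi>\<close>,
  whatever the answers. The quantified remaining budget \<open>c\<close> lets phases be chained
  without composing trees.\<close>

definition forces where
  "forces k D v \<Psi> \<longleftrightarrow>
     (\<forall>c. (\<forall>D' v'. extends D v D' v' \<longrightarrow> \<Psi> D' v' \<longrightarrow> win c D' v') \<longrightarrow> win (k + c) D v)"

lemma agree_value:
  assumes "valuation_profile n v" "valuation_profile n v'" "agree D v v'" "D \<subseteq> {0..1}"
    "i < n" "a \<in> D" "b \<in> D" "a \<le> b"
  shows "v' i a b = v i a b"
proof -
  have "additive (v i)" "additive (v' i)"
    using assms by (auto simp: valuation_profile_def valuation_additive)
  then have "v i a b = v i 0 b - v i 0 a" "v' i a b = v' i 0 b - v' i 0 a"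
    using assms by (auto intro!: additive_diff)
  then show ?thesis using assms by (auto simp: agree_def)
qed

lemma agree_piece_value:
  assumes "valuation_profile n v" "valuation_profile n v'" "agree D v v'" "D \<subseteq> {0..1}"
    "i < n" "piece_in D P"
  shows "piece_value (v' i) P = piece_value (v i) P"
  using assms(6) by (induction P) (auto simp: agree_value[OF assms(1-5)])

lemma win_mono: "win c D v \<Longrightarrow> c \<le> c' \<Longrightarrow> win c' D v"
  unfolding win_def by (meson mult_le_mono2 rw_solves_mono)

text \<open>After the cut and one evaluation per agent, the profiles still possible are those
  agreeing on \<open>insert y D\<close>, so a tree that wins from there serves all of them.\<close>

lemma win_cut:
  assumes v: "valuation_profile n v" and i: "i < n" and D: "D \<subseteq> {0..1}" "x \<in> D" "x' \<in> D" "x \<le> x'"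
    and t: "0 \<le> t" "t \<le> v i x x'"
    and next_win: "\<And>y v'. valuation_profile n v' \<Longrightarrow> agree D v v' \<Longrightarrow> x \<le> y \<Longrightarrow> y \<le> x' \<Longrightarrow>
          v' i x y = t \<Longrightarrow> win c (insert y D) v'"
  shows "win (Suc c) D v"
proof -
  \<comment> \<open>The subtree must be a function of the answers alone, not of the actual profile.
    \<open>good\<close> therefore mentions only \<open>z\<close> and \<open>w\<close>, and choice
    picks a suitable tree.\<close>
  define good where "good z w P \<longleftrightarrow> (\<forall>v'. valuation_profile n v' \<longrightarrow> agree D v v' \<longrightarrow>
      (\<forall>j<n. v' j 0 z = w j) \<longrightarrow> rw_solves n v' (G v') P c (n * c))" for z w P
  \<comment> \<open>An admissible answer may lie beyond \<open>x'\<close>, across a stretch worth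
    nothing to \<open>i\<close>; replacing it by the minimum keeps the value \<open>t\<close> and
    stays inside the interval.\<close>
  define P where "P = Cut i x t (\<lambda>y. ask n (min y x') (\<lambda>_. 0) (\<lambda>w. SOME P. good (min y x') w P))"
  have "rw_solves n v' (G v') P (Suc c) (n * Suc c)"
    if v': "valuation_profile n v'" "agree D v v'" for v'
  proof -
    have x01: "0 \<le> x" "x \<le> 1" "x' \<le> 1" using D by auto
    have val: "valuation (v' i)" using v' i by (simp add: valuation_profile_def)
    have vx: "v' i x x' = v i x x'" using agree_value[OF v v' D(1) i D(2,3,4)] .
    obtain y0 where y0: "x \<le> y0" "y0 \<le> x'" "v' i x y0 = t"
      using valuation_cut_exists[OF val, of x x' t] x01 D t vx by auto
    have branch: "rw_solves n v' (G v') (ask n (min y x') (\<lambda>_. 0) (\<lambda>w. SOME P. good (min y x') w P)) c (n + n * c)"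
      if y: "x \<le> y" "y \<le> 1" "v' i x y = t" for y
    proof -
      define z where "z = min y x'"
      have z: "x \<le> z" "z \<le> x'" using y D by (auto simp: z_def)
      have zt: "v' i x z = t"
      proof (cases "y \<le> x'")
        case True
        then show ?thesis using y by (simp add: z_def)
      next
        case False
        have "v' i x y = v' i x x' + v' i x' y"
          using additiveD[OF valuation_additive[OF val], of x x' y] x01 y False D by auto
        moreover have "0 \<le> v' i x' y"
          using valuation_nonneg[OF val, of x' y] x01 y False D by auto
        ultimately show ?thesis using False y t vx by (auto simp: z_def)
      qed
      have "win c (insert z D) v'"
        using next_win[OF v' z zt] .
      then obtain P0 where P0: "\<And>v''. valuation_profile n v'' \<Longrightarrow> agree (insert z D) v' v'' \<Longrightarrow>
          rw_solves n v'' (G v'') P0 c (n * c)" unfolding win_def by blast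
      \<comment> \<open>The default 0 is the function that \<open>ask\<close> starts from, so the
        continuation receives exactly this \<open>w\<close>.\<close>
      define w where "w = (\<lambda>j. if j < n then v' j 0 z else 0)"
      have "good z w P0"
        unfolding good_def using P0 v' by (auto simp: agree_def w_def)
      then have "good z w (SOME P. good z w P)" by (rule someI)
      then have "rw_solves n v' (G v') (SOME P. good z w P) c (n * c)"
        unfolding good_def using v' by (auto simp: w_def)
      then show ?thesis unfolding z_def[symmetric]
        using rw_solves_ask[where m=n and n=n and w="\<lambda>_. 0" and z=z and k="\<lambda>w. SOME P. good z w P"] z x01
        by (simp add: w_def)
    qed
    have "\<exists>y. x \<le> y \<and> y \<le> 1 \<and> v' i x y = t" using y0 x01 by force
    then show ?thesis unfolding P_def using branch i x01
      by (auto intro!: rw_solves.cut simp: add.commute)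
  qed
  then show ?thesis unfolding win_def by blast
qed

section \<open>Chaining phases of the game\<close>

lemma extends_trans:
  "extends D v D' v' \<Longrightarrow> extends D' v' D'' v'' \<Longrightarrow> extends D v D'' v''"
  unfolding extends_def agree_def by (metis (no_types, lifting) subset_eq)

lemma extends_refl: "valuation_profile n v \<Longrightarrow> D \<subseteq> {0..1} \<Longrightarrow> extends D v D v"
  by (auto simp: extends_def agree_def)

lemma extends_piece_value:
  "valuation_profile n v \<Longrightarrow> extends D v D' v' \<Longrightarrow> i < n \<Longrightarrow> piece_in D P \<Longrightarrow>
    piece_value (v' i) P = piece_value (v i) P"
  unfolding extends_def using agree_piece_value by auto

lemma extends_piece_in: "extends D v D' v' \<Longrightarrow> piece_in D P \<Longrightarrow> piece_in D' P"
  by (auto simp: extends_def intro: piece_in_mono)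

text \<open>The guard \<open>extends D v D'' v''\<close> keeps the starting position available, so
  facts known at the outset can still be transported to the end.\<close>

lemma forces_bind:
  assumes "forces k D v \<Psi>"
    and "\<And>D' v'. extends D v D' v' \<Longrightarrow> \<Psi> D' v' \<Longrightarrow> forces k' D' v' (\<lambda>D'' v''. extends D v D'' v'' \<longrightarrow> \<Psi>' D'' v'')"
  shows "forces (k + k') D v \<Psi>'"
  unfolding forces_def
proof (intro allI impI)
  fix c assume *: "\<forall>D' v'. extends D v D' v' \<longrightarrow> \<Psi>' D' v' \<longrightarrow> win c D' v'"
  have "win (k' + c) D' v'" if "extends D v D' v'" "\<Psi> D' v'" for D' v'
    using assms(2)[OF that] * extends_trans[OF that(1)] unfolding forces_def by blast
  then have "win (k + (k' + c)) D v" using assms(1) unfolding forces_def by blast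
  then show "win (k + k' + c) D v" by (simp add: add.assoc)
qed

lemma forces_weaken:
  assumes "forces k D v \<Psi>" "k \<le> k'"
    and "\<And>D' v'. extends D v D' v' \<Longrightarrow> \<Psi> D' v' \<Longrightarrow> \<Psi>' D' v'"
  shows "forces k' D v \<Psi>'"
  unfolding forces_def
proof (intro allI impI)
  fix c assume "\<forall>D' v'. extends D v D' v' \<longrightarrow> \<Psi>' D' v' \<longrightarrow> win c D' v'"
  then have "win (k + c) D v" using assms unfolding forces_def by blast
  then show "win (k' + c) D v" using assms(2) win_mono by fastforce
qed

lemma forces_win:
  "forces k D v \<Psi> \<Longrightarrow> (\<And>D' v'. extends D v D' v' \<Longrightarrow> \<Psi> D' v' \<Longrightarrow> win c D' v') \<Longrightarrow> win (k + c) D v"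
  unfolding forces_def by blast

lemma forces_done:
  "valuation_profile n v \<Longrightarrow> D \<subseteq> {0..1} \<Longrightarrow> \<Psi> D v \<Longrightarrow> forces k D v \<Psi>"
  unfolding forces_def using extends_refl win_mono by (meson le_add2)

lemma forces_cut:
  assumes "valuation_profile n v" "i < n" "D \<subseteq> {0..1}" "x \<in> D" "x' \<in> D" "x \<le> x'"
    "0 \<le> t" "t \<le> v i x x'"
  shows "forces 1 D v (\<lambda>D' v'. \<exists>y\<in>D'. x \<le> y \<and> y \<le> x' \<and> v' i x y = t)"
  unfolding forces_def
proof (intro allI impI)
  fix c assume *: "\<forall>D' v'. extends D v D' v' \<longrightarrow> (\<exists>y\<in>D'. x \<le> y \<and> y \<le> x' \<and> v' i x y = t) \<longrightarrow> win c D' v'"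
  have "win (Suc c) D v"
  proof (rule win_cut[OF assms])
    fix y v' assume y: "valuation_profile n v'" "agree D v v'" "x \<le> y" "y \<le> x'" "v' i x y = t"
    have "x \<ge> 0" "x' \<le> 1" using assms(3-5) by auto
    with y assms(3) have "extends D v (insert y D) v'" by (auto simp: extends_def)
    with * y show "win c (insert y D) v'" by blast
  qed
  then show "win (1 + c) D v" by simp
qed

section \<open>Trimming and equal division\<close>

text \<open>Only the interval in which the running value reaches \<open>t\<close> is cut; earlier
  ones go whole to \<open>P1\<close>, later ones to \<open>P2\<close>. Hence one cut is enough for
  any number of intervals.\<close>

lemma forces_trim:
  assumes v: "valuation_profile n v" and i: "i < n" and D: "D \<subseteq> {0..1}"
  shows "piece_in D P \<Longrightarrow> 0 \<le> t \<Longrightarrow> t \<le> piece_value (v i) P \<Longrightarrow>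
    forces 1 D v (\<lambda>D' v'. \<exists>P1 P2. piece_in D' P1 \<and> piece_in D' P2 \<and> piece_value (v' i) P1 = t \<and>
      (\<forall>f. additive f \<longrightarrow> piece_value f P = piece_value f P1 + piece_value f P2))"
proof (induction P arbitrary: t)
  case Nil
  then show ?case by (intro forces_done[OF v D] exI[of _ "[]"]) auto
next
  case (Cons p P)
  obtain a b where p: "p = (a,b)" by force
  have ab: "a \<in> D" "b \<in> D" "a \<le> b" "piece_in D P" using Cons.prems p by auto
  show ?case
  proof (cases "t \<le> v i a b")
    case True
    show ?thesis
    proof (rule forces_weaken[OF forces_cut[OF v i D ab(1-3) Cons.prems(2) True]])
      fix D' v' assume ext: "extends D v D' v'" and "\<exists>y\<in>D'. a \<le> y \<and> y \<le> b \<and> v' i a y = t"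
      then obtain y where y: "y \<in> D'" "a \<le> y" "y \<le> b" "v' i a y = t" by blast
      have D': "a \<in> D'" "b \<in> D'" "0 \<le> a" "b \<le> 1" "piece_in D' P"
        using ext ab D extends_piece_in by (auto simp: extends_def)
      then show "\<exists>P1 P2. piece_in D' P1 \<and> piece_in D' P2 \<and> piece_value (v' i) P1 = t \<and>
          (\<forall>f. additive f \<longrightarrow> piece_value f (p # P) = piece_value f P1 + piece_value f P2)"
        using y p by (intro exI[of _ "[(a,y)]"] exI[of _ "(y,b) # P"]) (auto simp: additiveD[of _ a y b])
    qed simp
  next
    case False
    then have "0 \<le> t - v i a b" "t - v i a b \<le> piece_value (v i) P" using Cons.prems p by auto
    from Cons.IH[OF ab(4) this] show ?thesis
    proof (rule forces_weaken)
      fix D' v' assume ext: "extends D v D' v'" and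
        "\<exists>P1 P2. piece_in D' P1 \<and> piece_in D' P2 \<and> piece_value (v' i) P1 = t - v i a b \<and>
          (\<forall>f. additive f \<longrightarrow> piece_value f P = piece_value f P1 + piece_value f P2)"
      then obtain P1 P2 where *: "piece_in D' P1" "piece_in D' P2"
          "piece_value (v' i) P1 = t - v i a b"
          "\<And>f. additive f \<Longrightarrow> piece_value f P = piece_value f P1 + piece_value f P2" by blast
      have D': "a \<in> D'" "b \<in> D'" using ext ab by (auto simp: extends_def)
      have "v' i a b = v i a b"
        using agree_value[OF v _ _ D i ab(1-3)] ext by (auto simp: extends_def)
      then show "\<exists>P1 P2. piece_in D' P1 \<and> piece_in D' P2 \<and> piece_value (v' i) P1 = t \<and>
          (\<forall>f. additive f \<longrightarrow> piece_value f (p # P) = piece_value f P1 + piece_value f P2)"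
        using * D' ab p by (intro exI[of _ "(a,b) # P1"] exI[of _ P2]) auto
    qed simp
  qed
qed

text \<open>Parts of value \<open>s\<close> are trimmed off one at a time; what is left after
  \<open>k\<close> cuts has value \<open>s\<close> by itself.\<close>

lemma forces_equal_split:
  assumes i: "i < n" and s: "0 \<le> s"
  shows "valuation_profile n v \<Longrightarrow> D \<subseteq> {0..1} \<Longrightarrow> piece_in D P \<Longrightarrow> piece_value (v i) P = real (Suc k) * s \<Longrightarrow>
    forces k D v (\<lambda>D' v'. \<exists>Ps. length Ps = Suc k \<and> (\<forall>Q\<in>set Ps. piece_in D' Q \<and> piece_value (v' i) Q = s) \<and>
      (\<forall>f. additive f \<longrightarrow> piece_value f P = sum_list (map (piece_value f) Ps)))"
proof (induction k arbitrary: D v P)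
  case 0
  then show ?case by (intro forces_done exI[of _ "[P]"]) auto
next
  case (Suc k)
  note v = Suc.prems(1) and D = Suc.prems(2)
  let ?trim = "\<lambda>D' v'. \<exists>P1 P2. piece_in D' P1 \<and> piece_in D' P2 \<and> piece_value (v' i) P1 = s \<and>
      (\<forall>f. additive f \<longrightarrow> piece_value f P = piece_value f P1 + piece_value f P2)"
  have "s \<le> piece_value (v i) P" using Suc.prems s by (simp add: algebra_simps)
  then have "forces 1 D v ?trim" using forces_trim[OF v i D Suc.prems(3) s] by blast
  then have "forces (1 + k) D v (\<lambda>D' v'. \<exists>Ps. length Ps = Suc (Suc k) \<and>
      (\<forall>Q\<in>set Ps. piece_in D' Q \<and> piece_value (v' i) Q = s) \<and>
      (\<forall>f. additive f \<longrightarrow> piece_value f P = sum_list (map (piece_value f) Ps)))"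
  proof (rule forces_bind)
    fix D' v' assume ext: "extends D v D' v'" and "?trim D' v'"
    then obtain P1 P2 where *: "piece_in D' P1" "piece_in D' P2" "piece_value (v' i) P1 = s"
      "\<And>f. additive f \<Longrightarrow> piece_value f P = piece_value f P1 + piece_value f P2" by blast
    have v': "valuation_profile n v'" "D' \<subseteq> {0..1}" using ext by (auto simp: extends_def)
    have "additive (v' i)" using v' i by (auto simp: valuation_profile_def valuation_additive)
    then have "piece_value (v' i) P2 = real (Suc k) * s"
      using *(3) *(4)[of "v' i"] extends_piece_value[OF v ext i Suc.prems(3)] Suc.prems(4)
      by (simp add: algebra_simps)
    from Suc.IH[OF v' *(2) this]
    show "forces k D' v' (\<lambda>D'' v''. extends D v D'' v'' \<longrightarrow> (\<exists>Ps. length Ps = Suc (Suc k) \<and>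
      (\<forall>Q\<in>set Ps. piece_in D'' Q \<and> piece_value (v'' i) Q = s) \<and>
      (\<forall>f. additive f \<longrightarrow> piece_value f P = sum_list (map (piece_value f) Ps))))"
    proof (rule forces_weaken, simp, intro impI)
      fix D'' v'' assume ext': "extends D' v' D'' v''" and "\<exists>Ps. length Ps = Suc k \<and>
        (\<forall>Q\<in>set Ps. piece_in D'' Q \<and> piece_value (v'' i) Q = s) \<and>
        (\<forall>f. additive f \<longrightarrow> piece_value f P2 = sum_list (map (piece_value f) Ps))"
      then obtain Ps where Ps: "length Ps = Suc k" "\<forall>Q\<in>set Ps. piece_in D'' Q \<and> piece_value (v'' i) Q = s"
        "\<forall>f. additive f \<longrightarrow> piece_value f P2 = sum_list (map (piece_value f) Ps)" by blast
      show "\<exists>Ps. length Ps = Suc (Suc k) \<and>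
        (\<forall>Q\<in>set Ps. piece_in D'' Q \<and> piece_value (v'' i) Q = s) \<and>
        (\<forall>f. additive f \<longrightarrow> piece_value f P = sum_list (map (piece_value f) Ps))"
        using Ps * extends_piece_in[OF ext'] extends_piece_value[OF v'(1) ext' i]
        by (intro exI[of _ "P1 # Ps"]) auto
    qed
  qed
  then show ?case by simp
qed

end

section \<open>One round of the protocol\<close>

text \<open>Pieces may occur repeatedly in the list, so removing one occurrence is expressed by sums
  over all functions \<open>h\<close> rather than by sets.\<close>

lemma obtain_best:
  fixes g :: "'a \<Rightarrow> real"
  assumes "Ps \<noteq> []"
  obtains P Qs where "P \<in> set Ps" "set Qs \<subseteq> set Ps" "length Ps = Suc (length Qs)"
    "\<And>Q. Q \<in> set Ps \<Longrightarrow> g Q \<le> g P"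
    "\<And>h :: 'a \<Rightarrow> real. sum_list (map h Ps) = h P + sum_list (map h Qs)"
proof -
  have "Max (g ` set Ps) \<in> g ` set Ps" using assms by (intro Max_in) auto
  then obtain P where P: "P \<in> set Ps" "g P = Max (g ` set Ps)" by auto
  show thesis
  proof (rule that[of P "remove1 P Ps"])
    show "length Ps = Suc (length (remove1 P Ps))"
      using P assms by (simp add: length_remove1)
    show "g Q \<le> g P" if "Q \<in> set Ps" for Q using P that by simp
    show "sum_list (map h Ps) = h P + sum_list (map h (remove1 P Ps))" for h :: "'a \<Rightarrow> real"
      using P by (simp add: sum_list_map_remove1)
  qed (use P in \<open>auto dest: notin_set_remove1 set_remove1_subset[THEN subsetD]\<close>)
qed

text \<open>\<open>ns\<close> lists the neighbours of the root \<open>r\<close>, and \<open>W\<close> consists of those that have a child. A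
neighbour in \<open>W\<close> trims its favourite piece into \<open>X\<close> and \<open>T\<close>, and \<open>Y\<close> is its second favourite; which
of \<open>X\<close> and \<open>Y\<close> it keeps is decided only after the last round. A neighbour outside \<open>W\<close> takes its
favourite as \<open>X\<close>. The last piece \<open>Z\<close> goes to the root.\<close>

locale star_game = rw_game n G for n G +
  fixes r :: nat and ns :: "nat list" and W :: "nat set"
  assumes r: "r < n" and ns: "distinct ns" "\<And>a. a \<in> set ns \<Longrightarrow> a < n"
    and size: "n = Suc (\<Sum>a\<leftarrow>ns. if a \<in> W then 2 else 1)"
begin

definition share where
  "share D v s a X Y T Z \<longleftrightarrow> piece_in D X \<and> piece_in D Y \<and> piece_in D T \<and>
     piece_value (v r) X + piece_value (v r) T = s \<and>
     piece_value (v a) Z \<le> piece_value (v a) X \<and>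
     (if a \<in> W then piece_value (v a) X = piece_value (v a) Y \<and> piece_value (v r) Y = s
      else Y = [] \<and> T = [])"

lemma share_extends:
  assumes "valuation_profile n v" "extends D v D' v'" "a < n" "piece_in D Z" "share D v s a X Y T Z"
  shows "share D' v' s a X Y T Z"
proof -
  have D: "piece_in D X" "piece_in D Y" "piece_in D T"
    using assms(5) unfolding share_def by blast+
  have "piece_value (v' r) P = piece_value (v r) P \<and> piece_value (v' a) P = piece_value (v a) P \<and>
      piece_in D' P" if "piece_in D P" for P
    using that extends_piece_in[OF assms(2)] extends_piece_value[OF assms(1,2) r]
      extends_piece_value[OF assms(1-3)] by blast
  from this[OF D(1)] this[OF D(2)] this[OF D(3)] this[OF assms(4)] assms(5)
  show ?thesis unfolding share_def by simp
qed

text \<open>The last piece \<open>Z\<close> is unknown when \<open>a\<close> picks, but it lies in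
  the pool that \<open>a\<close> picks from, so \<open>a\<close> values it no more than its choice.
  Trimmings never return to the pool, hence the remaining pieces stay worth \<open>s\<close> to the
  root.\<close>

lemma forces_distribute:
  assumes "valuation_profile n v" "D \<subseteq> {0..1}"
    and "distinct as" "\<And>a. a \<in> set as \<Longrightarrow> a < n"
    and "length Ps = Suc (\<Sum>a\<leftarrow>as. if a \<in> W then 2 else 1)"
    and "\<And>Q. Q \<in> set Ps \<Longrightarrow> piece_in D Q \<and> piece_value (v r) Q = s"
  shows "forces (length as) D v (\<lambda>D' v'. \<exists>X Y T. \<exists>Z\<in>set Ps.
      (\<forall>a\<in>set as. share D' v' s a (X a) (Y a) (T a) Z) \<and>
      (\<forall>f. additive f \<longrightarrow> sum_list (map (piece_value f) Ps) = piece_value f Z +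
        (\<Sum>a\<in>set as. piece_value f (X a) + piece_value f (Y a) + piece_value f (T a))))"
  using assms
proof (induction as arbitrary: D v Ps)
  case Nil
  then obtain Z where "Ps = [Z]" by (auto simp: length_Suc_conv)
  with Nil show ?case by (intro forces_done) auto
next
  case (Cons a as)
  note v = Cons.prems(1) and D = Cons.prems(2)
  have a: "a < n" "a \<notin> set as" "distinct as" "\<And>b. b \<in> set as \<Longrightarrow> b < n"
    using Cons.prems by auto
  have "Ps \<noteq> []" using Cons.prems(5) by auto
  then obtain P1 Qs where P1: "P1 \<in> set Ps" "set Qs \<subseteq> set Ps" "length Ps = Suc (length Qs)"
    "\<And>Q. Q \<in> set Ps \<Longrightarrow> piece_value (v a) Q \<le> piece_value (v a) P1"
    "\<And>h :: piece \<Rightarrow> real. sum_list (map h Ps) = h P1 + sum_list (map h Qs)"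
    using obtain_best[of Ps "piece_value (v a)"] by metis
  have P1r: "piece_in D P1" "piece_value (v r) P1 = s" using P1 Cons.prems(6) by auto
  let ?goal = "\<lambda>as Ps D' v'. \<exists>X Y T. \<exists>Z\<in>set Ps.
      (\<forall>a\<in>set as. share D' v' s a (X a) (Y a) (T a) Z) \<and>
      (\<forall>f. additive f \<longrightarrow> sum_list (map (piece_value f) Ps) = piece_value f Z +
        (\<Sum>a\<in>set as. piece_value f (X a) + piece_value f (Y a) + piece_value f (T a)))"
  show ?case
  proof (cases "a \<in> W")
    case False
    have "forces (length as) D v (?goal as Qs)"
      using Cons.prems P1 False by (intro Cons.IH[OF v D a(3,4)]) auto
    then show ?thesis
    proof (rule forces_weaken)
      fix D' v' assume ext: "extends D v D' v'" and "?goal as Qs D' v'"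
      then obtain X Y T Z where Z: "Z \<in> set Qs"
        and sh: "\<And>a. a \<in> set as \<Longrightarrow> share D' v' s a (X a) (Y a) (T a) Z"
        and val: "\<And>f. additive f \<Longrightarrow> sum_list (map (piece_value f) Qs) = piece_value f Z +
          (\<Sum>a\<in>set as. piece_value f (X a) + piece_value f (Y a) + piece_value f (T a))" by blast
      have ZD: "Z \<in> set Ps" "piece_in D Z" using Z P1 Cons.prems(6) by auto
      have "share D v s a P1 [] [] Z"
        using P1r False P1(4)[OF ZD(1)] by (auto simp: share_def)
      from share_extends[OF v ext a(1) ZD(2) this] have "share D' v' s a P1 [] [] Z" .
      moreover have "(\<Sum>b\<in>set as. piece_value f ((X(a := P1)) b) + piece_value f ((Y(a := [])) b) +
           piece_value f ((T(a := [])) b)) =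
         (\<Sum>b\<in>set as. piece_value f (X b) + piece_value f (Y b) + piece_value f (T b))" for f
        using a(2) by (intro sum.cong) auto
      ultimately show "?goal (a # as) Ps D' v'"
        using ZD sh a(2) P1(5) val
        by (intro exI[of _ "X(a := P1)"] exI[of _ "Y(a := [])"] exI[of _ "T(a := [])"] bexI[of _ Z]) auto
    qed simp
  next
    case True
    have "Qs \<noteq> []" using P1(3) Cons.prems(5) True by auto
    then obtain P2 Rs where P2: "P2 \<in> set Qs" "set Rs \<subseteq> set Qs" "length Qs = Suc (length Rs)"
      "\<And>Q. Q \<in> set Qs \<Longrightarrow> piece_value (v a) Q \<le> piece_value (v a) P2"
      "\<And>h :: piece \<Rightarrow> real. sum_list (map h Qs) = h P2 + sum_list (map h Rs)"
      using obtain_best[of Qs "piece_value (v a)"] by metis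
    have P2r: "piece_in D P2" "piece_value (v r) P2 = s" using P1 P2 Cons.prems(6) by auto
    have "0 \<le> piece_value (v a) P2"
      using v a(1) D P2r by (intro piece_value_nonneg) (auto simp: valuation_profile_def)
    moreover have "piece_value (v a) P2 \<le> piece_value (v a) P1" using P1 P2 by auto
    ultimately have "forces 1 D v (\<lambda>D' v'. \<exists>X T. piece_in D' X \<and> piece_in D' T \<and>
        piece_value (v' a) X = piece_value (v a) P2 \<and>
        (\<forall>f. additive f \<longrightarrow> piece_value f P1 = piece_value f X + piece_value f T))"
      by (rule forces_trim[OF v a(1) D P1r(1)])
    then have "forces (1 + length as) D v (?goal (a # as) Ps)"
    proof (rule forces_bind)
      fix D' v' assume ext: "extends D v D' v'" and "\<exists>X T. piece_in D' X \<and> piece_in D' T \<and>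
        piece_value (v' a) X = piece_value (v a) P2 \<and>
        (\<forall>f. additive f \<longrightarrow> piece_value f P1 = piece_value f X + piece_value f T)"
      then obtain X0 T0 where X0: "piece_in D' X0" "piece_in D' T0"
        "piece_value (v' a) X0 = piece_value (v a) P2"
        "\<And>f. additive f \<Longrightarrow> piece_value f P1 = piece_value f X0 + piece_value f T0" by blast
      have v': "valuation_profile n v'" "D' \<subseteq> {0..1}" using ext by (auto simp: extends_def)
      have pool: "piece_in D' Q \<and> piece_value (v' r) Q = s" if "Q \<in> set Ps" for Q
        using Cons.prems(6)[OF that] extends_piece_in[OF ext] extends_piece_value[OF v ext r] by auto
      have "forces (length as) D' v' (?goal as Rs)"
        using Cons.prems P1 P2 True pool by (intro Cons.IH[OF v' a(3,4)]) auto
      then show "forces (length as) D' v' (\<lambda>D'' v''. extends D v D'' v'' \<longrightarrow> ?goal (a # as) Ps D'' v'')"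
      proof (rule forces_weaken, simp, intro impI)
        fix D'' v'' assume ext': "extends D' v' D'' v''" and "?goal as Rs D'' v''"
        then obtain X Y T Z where Z: "Z \<in> set Rs"
          and sh: "\<And>a. a \<in> set as \<Longrightarrow> share D'' v'' s a (X a) (Y a) (T a) Z"
          and val: "\<And>f. additive f \<Longrightarrow> sum_list (map (piece_value f) Rs) = piece_value f Z +
            (\<Sum>a\<in>set as. piece_value f (X a) + piece_value f (Y a) + piece_value f (T a))" by blast
        have ZD: "Z \<in> set Ps" "Z \<in> set Qs" "piece_in D Z" "piece_in D' Z"
          using Z P1 P2 Cons.prems(6) pool by auto
        have "additive (v' r)" using v' r by (auto simp: valuation_profile_def valuation_additive)
        then have "piece_value (v' r) X0 + piece_value (v' r) T0 = s"
          using X0(4) pool[OF P1(1)] by simp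
        moreover have "P2 \<in> set Ps" using P1 P2 by auto
        ultimately have "share D' v' s a X0 P2 T0 Z"
          using X0 pool True P2(4)[OF ZD(2)] extends_piece_value[OF v ext a(1) P2r(1)]
            extends_piece_value[OF v ext a(1) ZD(3)] by (auto simp: share_def)
        from share_extends[OF v'(1) ext' a(1) ZD(4) this] have "share D'' v'' s a X0 P2 T0 Z" .
        moreover have "(\<Sum>b\<in>set as. piece_value f ((X(a := X0)) b) + piece_value f ((Y(a := P2)) b) +
             piece_value f ((T(a := T0)) b)) =
           (\<Sum>b\<in>set as. piece_value f (X b) + piece_value f (Y b) + piece_value f (T b))" for f
          using a(2) by (intro sum.cong) auto
        ultimately show "?goal (a # as) Ps D'' v''"
          using ZD sh a(2) P1(5) P2(5) X0(4) val
          by (intro exI[of _ "X(a := X0)"] exI[of _ "Y(a := P2)"] exI[of _ "T(a := T0)"] bexI[of _ Z]) auto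
      qed
    qed
    then show ?thesis by simp
  qed
qed

definition round where
  "round D v R R' X Y T Z \<longleftrightarrow> piece_in D R \<and> piece_in D R' \<and> piece_in D Z \<and>
     (\<forall>a\<in>set ns. share D v (piece_value (v r) R / n) a (X a) (Y a) (T a) Z) \<and>
     piece_value (v r) Z = piece_value (v r) R / n \<and>
     (\<forall>f. additive f \<longrightarrow> piece_value f R = piece_value f Z +
        (\<Sum>a\<in>set ns. piece_value f (X a) + piece_value f (Y a)) + piece_value f R') \<and>
     R' = concat (map T ns)"

lemma round_extends:
  assumes "valuation_profile n v" "extends D v D' v'" "round D v R R' X Y T Z"
  shows "round D' v' R R' X Y T Z"
proof -
  have D: "piece_in D R" "piece_in D R'" "piece_in D Z"
    using assms(3) unfolding round_def by blast+
  have "piece_value (v' r) P = piece_value (v r) P \<and> piece_in D' P" if "piece_in D P" for P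
    using that extends_piece_in[OF assms(2)] extends_piece_value[OF assms(1,2) r] by blast
  note * = this[OF D(1)] this[OF D(2)] this[OF D(3)]
  have "share D' v' s a (X a) (Y a) (T a) Z"
    if "a \<in> set ns" "share D v s a (X a) (Y a) (T a) Z" for a s
    using share_extends[OF assms(1,2) ns(2)[OF that(1)] D(3) that(2)] .
  with * assms(3) show ?thesis unfolding round_def by simp
qed

lemma length_ns_less: "length ns < n"
proof -
  have "length as \<le> (\<Sum>a\<leftarrow>as. if a \<in> W then 2 else 1 :: nat)" for as by (induction as) auto
  from this[of ns] show ?thesis using size by simp
qed

lemma forces_round:
  assumes v: "valuation_profile n v" and D: "D \<subseteq> {0..1}" and R: "piece_in D R"
  shows "forces (2 * n) D v (\<lambda>D' v'. \<exists>R' X Y T Z. round D' v' R R' X Y T Z)"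
proof -
  obtain k where k: "n = Suc k" using r by (cases n) auto
  define s where "s = piece_value (v r) R / n"
  have s: "0 \<le> s" unfolding s_def
    using v r piece_value_nonneg[OF _ D R] by (simp add: valuation_profile_def)
  have "piece_value (v r) R = real (Suc k) * s" using k by (simp add: s_def)
  from forces_equal_split[OF r s v D R this]
  have "forces (k + length ns) D v (\<lambda>D' v'. \<exists>R' X Y T Z. round D' v' R R' X Y T Z)"
  proof (rule forces_bind)
    fix D' v' assume ext: "extends D v D' v'" and "\<exists>Ps. length Ps = Suc k \<and>
      (\<forall>Q\<in>set Ps. piece_in D' Q \<and> piece_value (v' r) Q = s) \<and>
      (\<forall>f. additive f \<longrightarrow> piece_value f R = sum_list (map (piece_value f) Ps))"
    then obtain Ps where Ps: "length Ps = Suc k" "\<And>Q. Q \<in> set Ps \<Longrightarrow> piece_in D' Q \<and> piece_value (v' r) Q = s"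
      "\<And>f. additive f \<Longrightarrow> piece_value f R = sum_list (map (piece_value f) Ps)" by blast
    have v': "valuation_profile n v'" "D' \<subseteq> {0..1}" using ext by (auto simp: extends_def)
    have len: "length Ps = Suc (\<Sum>a\<leftarrow>ns. if a \<in> W then 2 else 1)" using Ps(1) k size by simp
    have "forces (length ns) D' v' (\<lambda>D'' v''. \<exists>X Y T. \<exists>Z\<in>set Ps. (\<forall>a\<in>set ns. share D'' v'' s a (X a) (Y a) (T a) Z) \<and>
          (\<forall>f. additive f \<longrightarrow> sum_list (map (piece_value f) Ps) = piece_value f Z +
            (\<Sum>a\<in>set ns. piece_value f (X a) + piece_value f (Y a) + piece_value f (T a))))"
      using v' ns len Ps(2) by (intro forces_distribute) auto
    then
    show "forces (length ns) D' v' (\<lambda>D'' v''. extends D v D'' v'' \<longrightarrow> (\<exists>R' X Y T Z. round D'' v'' R R' X Y T Z))"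
    proof (rule forces_weaken, simp, intro impI)
      fix D'' v'' assume ext': "extends D' v' D'' v''" and ext2: "extends D v D'' v''" and
        "\<exists>X Y T. \<exists>Z\<in>set Ps. (\<forall>a\<in>set ns. share D'' v'' s a (X a) (Y a) (T a) Z) \<and>
          (\<forall>f. additive f \<longrightarrow> sum_list (map (piece_value f) Ps) = piece_value f Z +
            (\<Sum>a\<in>set ns. piece_value f (X a) + piece_value f (Y a) + piece_value f (T a)))"
      then obtain X Y T Z where Z: "Z \<in> set Ps"
        and sh: "\<And>a. a \<in> set ns \<Longrightarrow> share D'' v'' s a (X a) (Y a) (T a) Z"
        and val: "\<And>f. additive f \<Longrightarrow> sum_list (map (piece_value f) Ps) = piece_value f Z +
          (\<Sum>a\<in>set ns. piece_value f (X a) + piece_value f (Y a) + piece_value f (T a))" by blast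
      have "piece_value (v'' r) R / n = s"
        using extends_piece_value[OF v ext2 r R] by (simp add: s_def)
      moreover have "piece_value (v'' r) Z = s" "piece_in D'' Z"
        using Ps(2)[OF Z] extends_piece_value[OF v'(1) ext' r] extends_piece_in[OF ext'] by auto
      moreover have "piece_in D'' (T a)" if "a \<in> set ns" for a using sh[OF that] by (simp add: share_def)
      ultimately have "round D'' v'' R (concat (map T ns)) X Y T Z"
        unfolding round_def using extends_piece_in[OF ext2 R] sh Ps(3) val
        by (auto simp: piece_value_concat_map[OF ns(1)] sum.distrib)
      then show "\<exists>R' X Y T Z. round D'' v'' R R' X Y T Z" by blast
    qed
  qed
  \<comment> \<open>\<open>n - 1\<close> cuts for the equal division and at most
    \<open>n - 1\<close> for the trimmings.\<close>
  then show ?thesis using k length_ns_less by (rule_tac forces_weaken) auto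
qed

lemma forces_rounds:
  assumes v: "valuation_profile n v" and D: "D \<subseteq> {0..1}" and R: "piece_in D R0"
  shows "forces (K * (2 * n)) D v (\<lambda>D' v'. \<exists>R X Y T Z. R 0 = R0 \<and> piece_in D' (R K) \<and>
    (\<forall>t<K. round D' v' (R t) (R (Suc t)) (X t) (Y t) (T t) (Z t)))"
proof (induction K)
  case 0
  then show ?case using assms by (intro forces_done exI[of _ "\<lambda>_. R0"]) auto
next
  case (Suc K)
  let ?goal = "\<lambda>K D' v'. \<exists>R X Y T Z. R 0 = R0 \<and> piece_in D' (R K) \<and>
    (\<forall>t<K. round D' v' (R t) (R (Suc t)) (X t) (Y t) (T t) (Z t))"
  from Suc have "forces (K * (2 * n) + 2 * n) D v (?goal (Suc K))"
  proof (rule forces_bind)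
    fix D' v' assume ext: "extends D v D' v'" and "?goal K D' v'"
    then obtain R X Y T Z where R: "R 0 = R0" "piece_in D' (R K)"
      "\<And>t. t < K \<Longrightarrow> round D' v' (R t) (R (Suc t)) (X t) (Y t) (T t) (Z t)" by blast
    have v': "valuation_profile n v'" "D' \<subseteq> {0..1}" using ext by (auto simp: extends_def)
    from forces_round[OF v' R(2)]
    show "forces (2 * n) D' v' (\<lambda>D'' v''. extends D v D'' v'' \<longrightarrow> ?goal (Suc K) D'' v'')"
    proof (rule forces_weaken, simp, intro impI)
      fix D'' v'' assume ext': "extends D' v' D'' v''" and
        "\<exists>R' X Y T Z. round D'' v'' (R K) R' X Y T Z"
      then obtain R' X' Y' T' Z' where new: "round D'' v'' (R K) R' X' Y' T' Z'" by blast
      then have "piece_in D'' R'" unfolding round_def by blast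
      moreover have "round D'' v'' (R t) (R (Suc t)) (X t) (Y t) (T t) (Z t)" if "t < K" for t
        using round_extends[OF v'(1) ext' R(3)[OF that]] .
      ultimately show "?goal (Suc K) D'' v''" using R(1) new
        by (intro exI[of _ "R(Suc K := R')"] exI[of _ "X(K := X')"] exI[of _ "Y(K := Y')"]
            exI[of _ "T(K := T')"] exI[of _ "Z(K := Z')"]) (auto simp: less_Suc_eq)
    qed
  qed
  then show ?case by (simp add: add.commute)
qed

end

section \<open>From additive identities to allocations\<close>

lemma (in -) piece_value_sum_nth:
  "piece_value f P = (\<Sum>k<length P. f (fst (P ! k)) (snd (P ! k)))"
  by (simp add: piece_value_def sum_list_sum_nth case_prod_beta atLeast0LessThan)

text \<open>Testing the hypothesis on the additive function that indicates \<open>x \<in> [a,b)\<close>, or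
\<open>x \<in> (a,b]\<close> for \<open>x = 1\<close>, counts how many of the intervals contain \<open>x\<close>.\<close>

lemma is_allocation_if_additive:
  assumes D: "D \<subseteq> {0..1}" and A: "\<And>i. i < n \<Longrightarrow> piece_in D (A i)"
    and total: "\<And>f. additive f \<Longrightarrow> (\<Sum>i<n. piece_value f (A i)) = f 0 1"
  shows "is_allocation n A"
proof -
  define I where "I = (SIGMA i:{..<n}. {..<length (A i)})"
  have fin: "finite I" by (simp add: I_def)
  have sum_I: "(\<Sum>(i,k)\<in>I. f (fst (A i ! k)) (snd (A i ! k))) = f 0 1" if "additive f" for f
    using total[OF that] by (simp add: piece_value_sum_nth I_def sum.Sigma)
  have disj: "{fst (A i ! k)<..<snd (A i ! k)} \<inter> {fst (A j ! l)<..<snd (A j ! l)} = {}"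
    if ij: "i < n" "j < n" "k < length (A i)" "l < length (A j)" "(i,k) \<noteq> (j,l)" for i j k l
  proof (rule ccontr)
    assume "\<not> ?thesis"
    then obtain x where "x \<in> {fst (A i ! k)<..<snd (A i ! k)} \<inter> {fst (A j ! l)<..<snd (A j ! l)}"
      by blast
    then have x: "fst (A i ! k) < x" "x < snd (A i ! k)" "fst (A j ! l) < x" "x < snd (A j ! l)"
      by auto
    define f where "f a b = (if a \<le> x \<and> x < b then 1 else 0 :: real)" for a b
    have "additive f" by (auto simp: additive_def f_def)
    have "A i ! k \<in> set (A i)" using ij by simp
    then have "fst (A i ! k) \<in> D" "snd (A i ! k) \<in> D"
      using A[OF ij(1)] by (auto simp: piece_in_def case_prod_beta)
    then have x01: "0 \<le> x" "x < 1" using x D by force+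
    let ?g = "\<lambda>(i,k). f (fst (A i ! k)) (snd (A i ! k))"
    \<comment> \<open>Nonnegativity allows all summands except those of the two overlapping
      intervals to be dropped; these two alone already exceed \<open>f 0 1\<close>.\<close>
    have "0 \<le> f a b" for a b by (simp add: f_def)
    then have "sum ?g {(i,k),(j,l)} \<le> sum ?g I"
      using ij by (intro sum_mono2[OF fin]) (auto simp: I_def)
    moreover have "sum ?g {(i,k),(j,l)} = 2" using ij(5) x by (auto simp: f_def)
    moreover have "f 0 1 = 1" using x01 by (simp add: f_def)
    ultimately show False using sum_I[OF \<open>additive f\<close>] by simp
  qed
  have cover: "\<exists>i<n. \<exists>(a,b)\<in>set (A i). a \<le> x \<and> x \<le> b" if x: "0 \<le> x" "x \<le> 1" for x
  proof -
    define f where "f a b = (if x < 1 then if a \<le> x \<and> x < b then 1 else 0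
      else if a < x \<and> x \<le> b then 1 else 0 :: real)" for a b
    have "additive f" by (auto simp: additive_def f_def)
    have "f 0 1 \<noteq> 0" using x by (auto simp: f_def)
    then have "(\<Sum>(i,k)\<in>I. f (fst (A i ! k)) (snd (A i ! k))) \<noteq> 0" using sum_I[OF \<open>additive f\<close>] by simp
    then obtain p where p: "p \<in> I" "(\<lambda>(i,k). f (fst (A i ! k)) (snd (A i ! k))) p \<noteq> 0"
      by (meson sum.not_neutral_contains_not_neutral)
    obtain i k where ik: "p = (i,k)" by force
    then have "i < n" "A i ! k \<in> set (A i)" "f (fst (A i ! k)) (snd (A i ! k)) \<noteq> 0"
      using p by (auto simp: I_def)
    then show ?thesis
      by (intro exI[of _ i] conjI bexI[of _ "A i ! k"]) (auto simp: f_def split: if_splits prod.splits)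
  qed
  have "0 \<le> a \<and> a \<le> b \<and> b \<le> 1" if "i < n" "(a,b) \<in> set (A i)" for i a b
    using A[OF that(1)] that(2) D by (force simp: piece_in_def)
  moreover have "{0..1} \<subseteq> (\<Union>i<n. \<Union>(a,b)\<in>set (A i). {a..b})"
  proof
    fix x :: real assume "x \<in> {0..1}"
    then obtain i a b where "i < n" "(a,b) \<in> set (A i)" "a \<le> x" "x \<le> b" using cover[of x] by auto
    then show "x \<in> (\<Union>i<n. \<Union>(a,b)\<in>set (A i). {a..b})" by force
  qed
  ultimately show ?thesis unfolding is_allocation_def using disj by blast
qed

section \<open>Star graphs and the final allocation\<close>

locale star_graph = star_game n "locally_envy_free n E" r ns W for n E r ns W +
  fixes ch :: "nat \<Rightarrow> nat"
  assumes W: "W \<subseteq> set ns" and r_ns: "r \<notin> set ns"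
    and ch: "inj_on ch W" "ch ` W \<inter> insert r (set ns) = {}"
    and agents: "{..<n} = insert r (set ns \<union> ch ` W)"
    and edges: "\<And>u w. E u w \<Longrightarrow> u = r \<and> w \<in> set ns \<or> w = r \<and> u \<in> set ns \<or>
      u \<in> W \<and> w = ch u \<or> w \<in> W \<and> u = ch w"
begin

lemma ch_less: "a \<in> W \<Longrightarrow> ch a < n"
  using agents by blast

lemma finite_W: "finite W"
  using W finite_subset by blast

text \<open>Every member of \<open>W\<close> brings a further agent, its child, and the root adds
  one more. This is the source of the halving.\<close>

lemma card_W: "2 * card W < n"
proof -
  have "n = card (insert r (set ns \<union> ch ` W))" using agents by (metis card_lessThan)
  also have "\<dots> = Suc (card (set ns) + card (ch ` W))"
    using r_ns ch(2) finite_W by (subst card_insert_disjoint) (auto intro!: card_Un_disjoint)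
  finally show ?thesis using card_mono[OF _ W] by (simp add: card_image[OF ch(1)])
qed

text \<open>All pieces have endpoints in \<open>D\<close>, so comparisons made under
  \<open>v\<close> hold for every profile that is still possible. \<open>PA\<close> goes to the
  neighbours and \<open>PB\<close> to their children, and each kind of edge has its own
  hypothesis.\<close>

lemma win_final:
  assumes v: "valuation_profile n v" and D: "D \<subseteq> {0..1}"
    and pieces: "piece_in D PZ" "\<And>a. a \<in> set ns \<Longrightarrow> piece_in D (PA a) \<and> piece_in D (PB a)"
    and root: "\<And>a. a \<in> set ns \<Longrightarrow> piece_value (v r) (PA a) \<le> piece_value (v r) PZ"
    and nbr: "\<And>a. a \<in> set ns \<Longrightarrow> piece_value (v a) PZ \<le> piece_value (v a) (PA a)"
    and pair: "\<And>a. a \<in> W \<Longrightarrow> piece_value (v a) (PB a) \<le> piece_value (v a) (PA a)"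
      "\<And>a. a \<in> W \<Longrightarrow> piece_value (v (ch a)) (PA a) \<le> piece_value (v (ch a)) (PB a)"
    and single: "\<And>a. a \<in> set ns \<Longrightarrow> a \<notin> W \<Longrightarrow> PB a = []"
    and total: "\<And>f. additive f \<Longrightarrow>
      piece_value f PZ + (\<Sum>a\<in>set ns. piece_value f (PA a) + piece_value f (PB a)) = f 0 1"
  shows "win 0 D v"
proof -
  define A where "A i = (if i = r then PZ else if i \<in> set ns then PA i else PB (inv_into W ch i))" for i
  have A_r: "A r = PZ" by (simp add: A_def)
  have A_n: "A a = PA a" if "a \<in> set ns" for a using that r_ns by (auto simp: A_def)
  have A_c: "A (ch a) = PB a" if "a \<in> W" for a
    using that ch(2) inv_into_f_f[OF ch(1) that] by (auto simp: A_def)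
  have inD: "piece_in D (A i)" if "i < n" for i
  proof -
    from that have "i \<in> insert r (set ns \<union> ch ` W)" using agents by auto
    then show ?thesis using pieces A_r A_n A_c W by auto
  qed
  have "(\<Sum>i<n. piece_value f (A i)) = f 0 1" if f: "additive f" for f
  proof -
    have "(\<Sum>i<n. piece_value f (A i)) = piece_value f (A r) + (\<Sum>i\<in>set ns \<union> ch ` W. piece_value f (A i))"
      unfolding agents using r_ns ch(2) finite_W by (subst sum.insert) auto
    also have "(\<Sum>i\<in>set ns \<union> ch ` W. piece_value f (A i)) =
        (\<Sum>i\<in>set ns. piece_value f (A i)) + (\<Sum>i\<in>ch ` W. piece_value f (A i))"
      using ch(2) finite_W by (intro sum.union_disjoint) auto
    also have "(\<Sum>i\<in>ch ` W. piece_value f (A i)) = (\<Sum>a\<in>W. piece_value f (PB a))"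
      using A_c by (simp add: sum.reindex[OF ch(1)])
    also have "\<dots> = (\<Sum>a\<in>set ns. piece_value f (PB a))"
      using W single by (intro sum.mono_neutral_left) auto
    also have "(\<Sum>i\<in>set ns. piece_value f (A i)) = (\<Sum>a\<in>set ns. piece_value f (PA a))"
      using A_n by simp
    finally show ?thesis using total[OF f] by (simp add: A_r sum.distrib)
  qed
  then have alloc: "is_allocation n A" using inD by (intro is_allocation_if_additive[OF D])
  have "locally_envy_free n E v' A" if v': "valuation_profile n v'" "agree D v v'" for v'
  proof -
    have val: "piece_value (v' i) (A j) = piece_value (v i) (A j)" if "i < n" "j < n" for i j
      using agree_piece_value[OF v v' D that(1) inD[OF that(2)]] .
    have "piece_value (v i) (A j) \<le> piece_value (v i) (A i)" if "E i j" for i j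
      using edges[OF that] root nbr pair A_r A_n A_c W by auto
    then show ?thesis using alloc val by (auto simp: locally_envy_free_def)
  qed
  then have "\<forall>v'. valuation_profile n v' \<longrightarrow> agree D v v' \<longrightarrow>
      rw_solves n v' (locally_envy_free n E v') (Output A) 0 (n * 0)"
    by (auto intro: rw_solves.out)
  then show ?thesis unfolding win_def by blast
qed

end

section \<open>The position after the last round\<close>

locale star_rounds = star_graph n E r ns W ch for n E r ns W ch +
  fixes K :: nat and D v R X Y T Z
  assumes v: "valuation_profile n v" and D: "D \<subseteq> {0..1}" and R0: "R 0 = [(0,1)]"
    and R_K: "piece_in D (R K)"
    and rounds: "\<And>t. t < K \<Longrightarrow> round D v (R t) (R (Suc t)) (X t) (Y t) (T t) (Z t)"
begin

lemma val: "i < n \<Longrightarrow> valuation (v i)"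
  using v by (simp add: valuation_profile_def)

lemma nonneg: "i < n \<Longrightarrow> piece_in D P \<Longrightarrow> 0 \<le> piece_value (v i) P"
  using piece_value_nonneg[OF val D] .

lemma R_in: "t \<le> K \<Longrightarrow> piece_in D (R t)"
  using R_K rounds by (cases "t = K") (auto simp: round_def)

lemma share_t:
  assumes "t < K" "a \<in> set ns"
  shows "share D v (piece_value (v r) (R t) / n) a (X t a) (Y t a) (T t a) (Z t)"
  using rounds[OF assms(1)] assms(2) unfolding round_def by blast

lemma Z_t: "t < K \<Longrightarrow> piece_in D (Z t)" "t < K \<Longrightarrow> piece_value (v r) (Z t) = piece_value (v r) (R t) / n"
  using rounds[of t] unfolding round_def by blast+

lemma X_t: "t < K \<Longrightarrow> a \<in> set ns \<Longrightarrow> piece_in D (X t a)"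
  and Y_t: "t < K \<Longrightarrow> a \<in> set ns \<Longrightarrow> piece_in D (Y t a)"
  and T_t: "t < K \<Longrightarrow> a \<in> set ns \<Longrightarrow> piece_in D (T t a)"
  using share_t[of t a] unfolding share_def by blast+

lemma R_Suc:
  assumes "t < K"
  shows "piece_value f (R (Suc t)) = (\<Sum>a\<in>W. piece_value f (T t a))"
proof -
  have "R (Suc t) = concat (map (T t) ns)" using rounds[OF assms] unfolding round_def by blast
  then have "piece_value f (R (Suc t)) = (\<Sum>a\<in>set ns. piece_value f (T t a))"
    by (simp add: piece_value_concat_map[OF ns(1)])
  also have "\<dots> = (\<Sum>a\<in>W. piece_value f (T t a))"
    using W share_t[OF assms] by (intro sum.mono_neutral_right) (auto simp: share_def)
  finally show ?thesis .
qed

lemma total: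
  assumes "additive f"
  shows "m \<le> K \<Longrightarrow> f 0 1 = (\<Sum>t<m. piece_value f (Z t)) +
    (\<Sum>a\<in>set ns. \<Sum>t<m. piece_value f (X t a) + piece_value f (Y t a)) + piece_value f (R m)"
proof (induction m)
  case 0
  then show ?case by (simp add: R0)
next
  case (Suc m)
  have "piece_value f (R m) = piece_value f (Z m) +
      (\<Sum>a\<in>set ns. piece_value f (X m a) + piece_value f (Y m a)) + piece_value f (R (Suc m))"
    using rounds[of m] Suc.prems assms unfolding round_def by auto
  then show ?case using Suc by (simp add: sum.distrib)
qed

text \<open>The next residue consists of \<open>card W\<close> trimmings, each worth to the root at
  most one of the \<open>n\<close> equal pieces; \<open>card_W\<close> does the rest.\<close>

lemma halving:
  assumes "t < K"
  shows "2 * piece_value (v r) (R (Suc t)) \<le> piece_value (v r) (R t)"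
proof -
  define s where "s = piece_value (v r) (R t) / n"
  have s: "0 \<le> s" using nonneg[OF r R_in] assms by (simp add: s_def)
  have "piece_value (v r) (T t a) \<le> s" if "a \<in> W" for a
    using share_t[OF assms, of a] that W nonneg[OF r X_t[OF assms]] by (force simp: share_def s_def)
  then have "piece_value (v r) (R (Suc t)) \<le> card W * s"
    unfolding R_Suc[OF assms] by (rule sum_bounded_above)
  then have "2 * piece_value (v r) (R (Suc t)) \<le> real (2 * card W) * s" by simp
  also have "\<dots> \<le> real n * s" using card_W s by (intro mult_right_mono) auto
  also have "\<dots> = piece_value (v r) (R t)" using r by (simp add: s_def)
  finally show ?thesis .
qed

lemma geometric_decay:
  "t + j \<le> K \<Longrightarrow> 2 ^ j * piece_value (v r) (R (t + j)) \<le> piece_value (v r) (R t)"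
proof (induction j)
  case (Suc j)
  have "2 ^ j * (2 * piece_value (v r) (R (Suc (t + j)))) \<le> 2 ^ j * piece_value (v r) (R (t + j))"
    using halving[of "t + j"] Suc.prems by (intro mult_left_mono) auto
  also have "\<dots> \<le> piece_value (v r) (R t)" using Suc by simp
  finally show ?case by (simp add: mult.assoc mult.left_commute)
qed simp

text \<open>The signed stake of the child, positive if it would rather have \<open>X\<close>.
  Denying it the better piece turns the contribution \<open>\<bar>gain t a\<bar>\<close> to its
  advantage over \<open>a\<close> into the negative.\<close>

definition gain where
  "gain t a = piece_value (v (ch a)) (X t a) - piece_value (v (ch a)) (Y t a)"

text \<open>Among the first \<open>n\<close> rounds some neighbour \<open>a\<close> has the largest trimming twice. In the one of
the two rounds where its child has the smaller stake, the child can afford to leave the trimmed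
piece to \<open>a\<close>, and the root then prefers its share to that of \<open>a\<close> by the whole trimming.\<close>

lemma dominated_neighbour:
  assumes K: "K = 2 * n" and W_ne: "W \<noteq> {}"
  obtains a t0 where "a \<in> W" "t0 < K" "piece_value (v r) (R K) \<le> piece_value (v r) (T t0 a)"
    "\<bar>gain t0 a\<bar> \<le> (\<Sum>t\<in>{..<K} - {t0}. \<bar>gain t a\<bar>)"
proof -
  have "\<exists>a\<in>W. \<forall>b\<in>W. piece_value (v r) (T t b) \<le> piece_value (v r) (T t a)" for t
  proof -
    have "Max ((\<lambda>a. piece_value (v r) (T t a)) ` W) \<in> (\<lambda>a. piece_value (v r) (T t a)) ` W"
      using finite_W W_ne by (intro Max_in) auto
    then obtain a where a: "a \<in> W" "piece_value (v r) (T t a) = Max ((\<lambda>a. piece_value (v r) (T t a)) ` W)"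
      by auto
    have "piece_value (v r) (T t b) \<le> piece_value (v r) (T t a)" if "b \<in> W" for b
      unfolding a(2) using that finite_W by (intro Max_ge) auto
    then show ?thesis using a(1) by blast
  qed
  then obtain best where best: "\<And>t. best t \<in> W"
    "\<And>t b. b \<in> W \<Longrightarrow> piece_value (v r) (T t b) \<le> piece_value (v r) (T t (best t))" by metis
  \<comment> \<open>At least \<open>n\<close> halvings follow a round \<open>t < n\<close>, while
    the largest trimming is at least the fraction \<open>1 / card W\<close> of the residue it
    enters. Since \<open>card W \<le> 2 ^ n\<close>, it outweighs the final residue.\<close>
  have dom: "piece_value (v r) (R K) \<le> piece_value (v r) (T t (best t))" if t: "t < n" for t
  proof -
    let ?m = "piece_value (v r) (T t (best t))"
    have tK: "t < K" using t K by simp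
    have bn: "best t \<in> set ns" using best(1) W by blast
    have m: "0 \<le> ?m" using nonneg[OF r T_t[OF tK bn]] .
    have R_nn: "0 \<le> piece_value (v r) (R K)" using nonneg[OF r R_K] .
    have "2 ^ n * piece_value (v r) (R K) \<le> 2 ^ (K - Suc t) * piece_value (v r) (R K)"
      using t K R_nn by (intro mult_right_mono power_increasing) auto
    also have "\<dots> \<le> piece_value (v r) (R (Suc t))"
      using geometric_decay[of "Suc t" "K - Suc t"] tK by simp
    also have "\<dots> \<le> card W * ?m"
      unfolding R_Suc[OF tK] by (rule sum_bounded_above) (rule best(2))
    also have "\<dots> \<le> 2 ^ n * ?m"
    proof (rule mult_right_mono[OF _ m])
      have "card W \<le> 2 ^ n" using card_W less_exp[of n] by linarith
      then have "real (card W) \<le> real (2 ^ n)" by (rule of_nat_mono)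
      then show "real (card W) \<le> 2 ^ n" by simp
    qed
    finally show ?thesis by simp
  qed
  have "\<not> inj_on best {..<n}"
  proof
    assume "inj_on best {..<n}"
    then have "card {..<n} \<le> card W" using best(1) finite_W by (intro card_inj_on_le) auto
    then show False using card_W by simp
  qed
  then obtain t1 t2 where t: "t1 < n" "t2 < n" "t1 \<noteq> t2" "best t1 = best t2"
    by (auto simp: inj_on_def)
  \<comment> \<open>Of the two rounds, \<open>t0\<close> is the one where the child has the smaller
    stake.\<close>
  obtain t0 t' where t0: "t0 < n" "t' < n" "t0 \<noteq> t'" "best t0 = best t'"
    "\<bar>gain t0 (best t0)\<bar> \<le> \<bar>gain t' (best t0)\<bar>"
    using t by (metis linear)
  show thesis
  proof (rule that[OF best(1)])
    show "t0 < K" using t0 K by simp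
    show "piece_value (v r) (R K) \<le> piece_value (v r) (T t0 (best t0))" using dom[OF t0(1)] .
    have "\<bar>gain t' (best t0)\<bar> \<le> (\<Sum>t\<in>{..<K} - {t0}. \<bar>gain t (best t0)\<bar>)"
      using t0 K by (intro member_le_sum) auto
    then show "\<bar>gain t0 (best t0)\<bar> \<le> (\<Sum>t\<in>{..<K} - {t0}. \<bar>gain t (best t0)\<bar>)"
      using t0(5) by linarith
  qed
qed

text \<open>\<open>keep t a\<close> says that \<open>a\<close> rather than its child receives \<open>X t a\<close>; \<open>HA a\<close> and \<open>HB a\<close> are the
parts of the final residue that go to \<open>a\<close> and its child.\<close>

lemma win_assembled:
  fixes keep :: "nat \<Rightarrow> nat \<Rightarrow> bool"
  assumes keep_single: "\<And>t a. a \<notin> W \<Longrightarrow> keep t a"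
    and keep_child: "\<And>a. a \<in> W \<Longrightarrow> 0 \<le> (\<Sum>t<K. if keep t a then - gain t a else gain t a)"
    and H: "\<And>a. piece_in D (HA a)" "\<And>a. piece_in D (HB a)"
    and H_single: "\<And>a. a \<notin> W \<Longrightarrow> HB a = []"
    and H_nbr: "\<And>a. a \<in> W \<Longrightarrow> piece_value (v a) (HB a) \<le> piece_value (v a) (HA a)"
    and H_child: "\<And>a. a \<in> W \<Longrightarrow> piece_value (v (ch a)) (HA a) \<le> piece_value (v (ch a)) (HB a)"
    and H_root: "\<And>a. a \<in> set ns \<Longrightarrow> piece_value (v r) (HA a) \<le>
      (\<Sum>t<K. piece_value (v r) (Z t) - piece_value (v r) (if keep t a then X t a else Y t a))"
    and H_total: "\<And>f. additive f \<Longrightarrow>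
      (\<Sum>a\<in>set ns. piece_value f (HA a) + piece_value f (HB a)) = piece_value f (R K)"
  shows "win 0 D v"
proof -
  define G1 where "G1 t a = (if keep t a then X t a else Y t a)" for t a
  define G2 where "G2 t a = (if keep t a then Y t a else X t a)" for t a
  define PZ where "PZ = concat (map Z [0..<K])"
  define PA where "PA a = concat (map (\<lambda>t. G1 t a) [0..<K]) @ HA a" for a
  define PB where "PB a = concat (map (\<lambda>t. G2 t a) [0..<K]) @ HB a" for a
  have pZ: "piece_value f PZ = (\<Sum>t<K. piece_value f (Z t))" for f
    by (simp add: PZ_def piece_value_concat_map atLeast0LessThan)
  have pA: "piece_value f (PA a) = (\<Sum>t<K. piece_value f (G1 t a)) + piece_value f (HA a)" for f a
    by (simp add: PA_def piece_value_concat_map atLeast0LessThan)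
  have pB: "piece_value f (PB a) = (\<Sum>t<K. piece_value f (G2 t a)) + piece_value f (HB a)" for f a
    by (simp add: PB_def piece_value_concat_map atLeast0LessThan)
  show ?thesis
  proof (rule win_final[OF v D])
    show "piece_in D PZ" using Z_t(1) by (simp add: PZ_def)
    show "piece_in D (PA a) \<and> piece_in D (PB a)" if "a \<in> set ns" for a
      using X_t[OF _ that] Y_t[OF _ that] H by (simp add: PA_def PB_def G1_def G2_def)
    show "piece_value (v r) (PA a) \<le> piece_value (v r) PZ" if "a \<in> set ns" for a
      using H_root[OF that] by (simp add: pA pZ sum_subtractf G1_def)
    show "piece_value (v a) PZ \<le> piece_value (v a) (PA a)" if a: "a \<in> set ns" for a
    proof -
      \<comment> \<open>In \<open>W\<close> both \<open>X\<close> and \<open>Y\<close> are worth at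
        least \<open>Z\<close> to \<open>a\<close>; outside \<open>W\<close>,
        \<open>keep_single\<close> makes \<open>a\<close> hold \<open>X\<close>.\<close>
      have "piece_value (v a) (Z t) \<le> piece_value (v a) (G1 t a)" if "t < K" for t
        using share_t[OF that a] keep_single[of a t] by (auto simp: share_def G1_def split: if_splits)
      then have "(\<Sum>t<K. piece_value (v a) (Z t)) \<le> (\<Sum>t<K. piece_value (v a) (G1 t a))"
        by (intro sum_mono) auto
      moreover have "0 \<le> piece_value (v a) (HA a)" using nonneg[OF ns(2)[OF a] H(1)] .
      ultimately show ?thesis by (simp add: pA pZ)
    qed
    show "piece_value (v a) (PB a) \<le> piece_value (v a) (PA a)" if a: "a \<in> W" for a
    proof -
      have "piece_value (v a) (G2 t a) = piece_value (v a) (G1 t a)" if "t < K" for t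
        using share_t[OF that, of a] a W by (auto simp: share_def G1_def G2_def)
      then show ?thesis using H_nbr[OF a] by (simp add: pA pB)
    qed
    show "piece_value (v (ch a)) (PA a) \<le> piece_value (v (ch a)) (PB a)" if a: "a \<in> W" for a
    proof -
      have "(\<Sum>t<K. if keep t a then - gain t a else gain t a) =
          (\<Sum>t<K. piece_value (v (ch a)) (G2 t a) - piece_value (v (ch a)) (G1 t a))"
        by (intro sum.cong) (auto simp: gain_def G1_def G2_def)
      then show ?thesis using keep_child[OF a] H_child[OF a] by (simp add: pA pB sum_subtractf)
    qed
    show "PB a = []" if "a \<in> set ns" "a \<notin> W" for a
      using share_t[OF _ that(1)] that keep_single[OF that(2)] H_single[OF that(2)]
      by (simp add: PB_def G2_def share_def)
    show "piece_value f PZ + (\<Sum>a\<in>set ns. piece_value f (PA a) + piece_value f (PB a)) = f 0 1"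
      if f: "additive f" for f
    proof -
      have "piece_value f (PA a) + piece_value f (PB a) =
          (\<Sum>t<K. piece_value f (X t a) + piece_value f (Y t a)) + (piece_value f (HA a) + piece_value f (HB a))" for a
      proof -
        have "(\<Sum>t<K. piece_value f (G1 t a)) + (\<Sum>t<K. piece_value f (G2 t a)) =
            (\<Sum>t<K. piece_value f (X t a) + piece_value f (Y t a))"
          unfolding sum.distrib[symmetric] by (intro sum.cong) (auto simp: G1_def G2_def)
        then show ?thesis by (simp add: pA pB)
      qed
      then show ?thesis using total[OF f, of K] H_total[OF f] by (simp add: pZ sum.distrib)
    qed
  qed
qed

text \<open>Without trimmings a single round leaves a residue of value 0 under every additive
  function, so nothing remains to be divided.\<close>

lemma win_no_children:
  assumes "W = {}" "0 < K"
  shows "win 0 D v"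
proof (rule win_assembled[where keep="\<lambda>_ _. True" and HA="\<lambda>_. []" and HB="\<lambda>_. []"])
  show "piece_value (v r) [] \<le>
      (\<Sum>t<K. piece_value (v r) (Z t) - piece_value (v r) (if True then X t a else Y t a))"
    if a: "a \<in> set ns" for a
  proof -
    have "piece_value (v r) (X t a) \<le> piece_value (v r) (Z t)" if "t < K" for t
      using share_t[OF that a] Z_t(2)[OF that] nonneg[OF r T_t[OF that a]] by (simp add: share_def)
    then show ?thesis by (auto intro!: sum_nonneg)
  qed
  show "(\<Sum>a\<in>set ns. piece_value f [] + piece_value f []) = piece_value f (R K)" if "additive f" for f
    using R_Suc[of "K - 1" f] assms by simp
qed (use assms in auto)

text \<open>Each child gets its preferred piece except in round \<open>t0\<close> at
  \<open>a\<close>. The surplus of the root over a neighbour in a round is the trimming or 0, so it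
  never turns negative, and at \<open>t0\<close> it covers the whole residue.\<close>

lemma win_dominated:
  assumes a: "a \<in> W" "t0 < K" "piece_value (v r) (R K) \<le> piece_value (v r) (T t0 a)"
    "\<bar>gain t0 a\<bar> \<le> (\<Sum>t\<in>{..<K} - {t0}. \<bar>gain t a\<bar>)"
    and H: "piece_in D H1" "piece_in D H2"
      "\<And>f. additive f \<Longrightarrow> piece_value f (R K) = piece_value f H1 + piece_value f H2"
      "piece_value (v a) H1 = piece_value (v a) H2"
      "piece_value (v (ch a)) H1 \<le> piece_value (v (ch a)) H2"
  shows "win 0 D v"
proof -
  define keep where "keep t b \<longleftrightarrow> b \<notin> W \<or> gain t b \<le> 0 \<or> (t = t0 \<and> b = a)" for t b
  have ans: "a \<in> set ns" using a W by blast
  have loss: "0 \<le> piece_value (v r) (Z t) - piece_value (v r) (if keep t b then X t b else Y t b)"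
    if "t < K" "b \<in> set ns" for t b
    using share_t[OF that] Z_t(2)[OF that(1)] nonneg[OF r T_t[OF that]]
    by (auto simp: share_def keep_def split: if_splits)
  show ?thesis
  proof (rule win_assembled[where keep=keep and HA="\<lambda>b. if b = a then H1 else []"
        and HB="\<lambda>b. if b = a then H2 else []"])
    show "0 \<le> (\<Sum>t<K. if keep t b then - gain t b else gain t b)" if b: "b \<in> W" for b
    proof (cases "b = a")
      case False
      then show ?thesis using b by (intro sum_nonneg) (auto simp: keep_def)
    next
      case True
      \<comment> \<open>Only \<open>t0\<close> can count against the child; every other round
        contributes an absolute value.\<close>
      have "(\<Sum>t<K. if keep t a then - gain t a else gain t a) =
          - gain t0 a + (\<Sum>t\<in>{..<K} - {t0}. if keep t a then - gain t a else gain t a)"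
        using a by (subst sum.remove[of _ t0]) (auto simp: keep_def)
      also have "(\<Sum>t\<in>{..<K} - {t0}. if keep t a then - gain t a else gain t a) =
          (\<Sum>t\<in>{..<K} - {t0}. \<bar>gain t a\<bar>)"
        using a by (intro sum.cong) (auto simp: keep_def)
      finally show ?thesis using a(4) unfolding True by linarith
    qed
    show "piece_value (v r) (if b = a then H1 else []) \<le>
        (\<Sum>t<K. piece_value (v r) (Z t) - piece_value (v r) (if keep t b then X t b else Y t b))"
      if b: "b \<in> set ns" for b
    proof (cases "b = a")
      case False
      then show ?thesis using loss[OF _ b] by (auto intro!: sum_nonneg)
    next
      case True
      have "additive (v r)" using valuation_additive[OF val[OF r]] .
      \<comment> \<open>Either half may fall to \<open>a\<close>, so \<open>H1\<close> is bounded by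
        the entire residue.\<close>
      then have "piece_value (v r) H1 \<le> piece_value (v r) (R K)"
        using H(3)[of "v r"] nonneg[OF r H(2)] by simp
      also have "\<dots> \<le> piece_value (v r) (Z t0) - piece_value (v r) (if keep t0 a then X t0 a else Y t0 a)"
        using a(3) share_t[OF a(2) ans] Z_t(2)[OF a(2)] by (auto simp: share_def keep_def)
      also have "\<dots> \<le> (\<Sum>t<K. piece_value (v r) (Z t) - piece_value (v r) (if keep t a then X t a else Y t a))"
        using a(2) loss[OF _ ans] by (intro member_le_sum) auto
      finally show ?thesis unfolding True by simp
    qed
    show "(\<Sum>b\<in>set ns. piece_value f (if b = a then H1 else []) + piece_value f (if b = a then H2 else [])) =
        piece_value f (R K)" if "additive f" for f
    proof -
      have "(\<Sum>b\<in>set ns. piece_value f (if b = a then H1 else []) + piece_value f (if b = a then H2 else [])) =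
          (\<Sum>b\<in>set ns. if b = a then piece_value f H1 + piece_value f H2 else 0)"
        by (intro sum.cong) auto
      then show ?thesis using H(3)[OF that] ans by simp
    qed
  qed (use a H in \<open>auto simp: keep_def\<close>)
qed

lemma star_rounds_extends:
  assumes "extends D v D' v'"
  shows "star_rounds n E r ns W ch K D' v' R X Y T Z"
  using assms extends_piece_in[OF assms R_K] round_extends[OF v assms rounds] R0
  by unfold_locales (auto simp: extends_def)

text \<open>\<open>a\<close> halves the residue in its own measure and so accepts either part, while
  the child takes the better one. That is the single remaining cut.\<close>

lemma win_rounds:
  assumes K: "K = 2 * n"
  shows "win 1 D v"
proof (cases "W = {}")
  case True
  then have "win 0 D v" using win_no_children K r by simp
  then show ?thesis by (rule win_mono) simp
next
  case False
  obtain a t0 where a: "a \<in> W" "t0 < K" "piece_value (v r) (R K) \<le> piece_value (v r) (T t0 a)"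
    "\<bar>gain t0 a\<bar> \<le> (\<Sum>t\<in>{..<K} - {t0}. \<bar>gain t a\<bar>)"
    using dominated_neighbour[OF K False] by metis
  have ans: "a \<in> set ns" using a W by blast
  have an: "a < n" using ns(2)[OF ans] .
  have half: "0 \<le> piece_value (v a) (R K) / 2" "piece_value (v a) (R K) / 2 \<le> piece_value (v a) (R K)"
    using nonneg[OF an R_K] by auto
  from forces_trim[OF v an D R_K half]
  have "win (1 + 0) D v"
  proof (rule forces_win)
    fix D' v' assume ext: "extends D v D' v'" and "\<exists>P1 P2. piece_in D' P1 \<and> piece_in D' P2 \<and>
      piece_value (v' a) P1 = piece_value (v a) (R K) / 2 \<and>
      (\<forall>f. additive f \<longrightarrow> piece_value f (R K) = piece_value f P1 + piece_value f P2)"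
    then obtain P1 P2 where P: "piece_in D' P1" "piece_in D' P2"
      "piece_value (v' a) P1 = piece_value (v a) (R K) / 2"
      "\<And>f. additive f \<Longrightarrow> piece_value f (R K) = piece_value f P1 + piece_value f P2" by blast
    interpret ext: star_rounds n E r ns W ch K D' v' R X Y T Z
      using star_rounds_extends[OF ext] .
    note pv = extends_piece_value[OF v ext]
    \<comment> \<open>The profile may be replaced by another compatible one; stakes survive because
      the pieces of the rounds have endpoints in \<open>D\<close>.\<close>
    have "ext.gain t a = gain t a" if "t < K" for t
      using pv[OF ch_less[OF a(1)]] X_t[OF that ans] Y_t[OF that ans] by (simp add: gain_def ext.gain_def)
    then have gain: "\<bar>ext.gain t0 a\<bar> \<le> (\<Sum>t\<in>{..<K} - {t0}. \<bar>ext.gain t a\<bar>)"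
      using a(2,4) by simp
    have dom: "piece_value (v' r) (R K) \<le> piece_value (v' r) (T t0 a)"
      using a(3) pv[OF r] R_K T_t[OF a(2) ans] by simp
    have halves: "piece_value (v' a) P1 = piece_value (v' a) P2"
      using P(3) P(4)[OF valuation_additive[OF ext.val[OF an]]] pv[OF an R_K] by simp
    show "win 0 D' v'"
    proof (cases "piece_value (v' (ch a)) P1 \<le> piece_value (v' (ch a)) P2")
      case True
      show ?thesis using ext.win_dominated[OF a(1,2) dom gain P(1,2,4) halves True] .
    next
      case False
      then show ?thesis using P(4)
        by (intro ext.win_dominated[OF a(1,2) dom gain P(2,1) _ halves[symmetric]]) auto
    qed
  qed
  then show ?thesis by simp
qed

end

section \<open>The cut count from the starting position\<close>

text \<open>There are \<open>2 * n\<close> rounds of at most \<open>2 * n\<close> cuts and one final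
  cut; the constant 5 absorbs that last cut because \<open>n\<close> is positive.\<close>

lemma (in star_graph) win_initial:
  assumes v: "valuation_profile n v"
  shows "win (5 * n\<^sup>2) {0,1} v"
proof -
  have D: "{0,1} \<subseteq> {0..1::real}" by auto
  have "piece_in {0,1} [(0,1)]" by simp
  from forces_rounds[OF v D this, of "2 * n"]
  have "win (2 * n * (2 * n) + 1) {0,1} v"
  proof (rule forces_win)
    fix D' v' assume ext: "extends {0,1} v D' v'" and
      "\<exists>R X Y T Z. R 0 = [(0,1)] \<and> piece_in D' (R (2 * n)) \<and>
        (\<forall>t<2 * n. round D' v' (R t) (R (Suc t)) (X t) (Y t) (T t) (Z t))"
    then obtain R X Y T Z where "R 0 = [(0,1)]" "piece_in D' (R (2 * n))"
      "\<And>t. t < 2 * n \<Longrightarrow> round D' v' (R t) (R (Suc t)) (X t) (Y t) (T t) (Z t)" by blast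
    with ext interpret star_rounds n E r ns W ch "2 * n" D' v' R X Y T Z
      by unfold_locales (auto simp: extends_def)
    show "win 1 D' v'" by (rule win_rounds) simp
  qed
  moreover have "2 * n * (2 * n) + 1 \<le> 5 * n\<^sup>2"
    using r by (cases n) (auto simp: power2_eq_square)
  ultimately show ?thesis by (rule win_mono)
qed

section \<open>Structure of 2-Stars\<close>

text \<open>Sending each non-root vertex to the edge to its parent is injective. As there are
  exactly \<open>n - 1\<close> edges, these are all of them.\<close>

lemma two_star_parent:
  assumes "two_star n E r"
  obtains par where "\<And>u w. E u w \<Longrightarrow> w \<noteq> r \<and> u = par w \<or> u \<noteq> r \<and> w = par u"
    "\<And>w. w < n \<Longrightarrow> w \<noteq> r \<Longrightarrow> E (par w) w \<and> (par w = r \<or> E r (par w) \<and> \<not> E r w)"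
proof -
  have E: "\<And>u w. E u w \<Longrightarrow> u < n \<and> w < n \<and> u \<noteq> w \<and> E w u"
    and dist: "\<And>w. w < n \<Longrightarrow> w = r \<or> E r w \<or> (\<exists>u. E r u \<and> E u w)"
    and card: "card {(u,w). u < w \<and> w < n \<and> E u w} = n - 1" and r: "r < n"
    using assms unfolding two_star_def by blast+
  define par where "par w = (if E r w then r else SOME u. E r u \<and> E u w)" for w
  have par: "E (par w) w \<and> (par w = r \<or> E r (par w) \<and> \<not> E r w)" if "w < n" "w \<noteq> r" for w
  proof (cases "E r w")
    case False
    then have "\<exists>u. E r u \<and> E u w" using dist[OF that(1)] that(2) by blast
    then have "E r (SOME u. E r u \<and> E u w) \<and> E (SOME u. E r u \<and> E u w) w" by (rule someI_ex)
    then show ?thesis using False by (simp add: par_def)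
  qed (simp add: par_def)
  define e where "e w = (min (par w) w, max (par w) w)" for w
  have inj: "inj_on e ({..<n} - {r})"
  proof
    fix x y assume xy: "x \<in> {..<n} - {r}" "y \<in> {..<n} - {r}" "e x = e y"
    show "x = y"
    proof (rule ccontr)
      assume "x \<noteq> y"
      then have "par x = y" "par y = x" using xy(3) by (auto simp: e_def min_def max_def split: if_splits)
      \<comment> \<open>As parent of \<open>x\<close>, the vertex \<open>y\<close> is adjacent to
        the root; as a vertex with parent \<open>x \<noteq> r\<close>, it is not.\<close>
      then show False using par[of x] par[of y] xy E by auto
    qed
  qed
  have "e ` ({..<n} - {r}) \<subseteq> {(u,w). u < w \<and> w < n \<and> E u w}"
  proof
    fix p assume "p \<in> e ` ({..<n} - {r})"
    then obtain w where w: "w < n" "w \<noteq> r" "p = e w" by auto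
    have "E (par w) w" using par w by blast
    then show "p \<in> {(u,w). u < w \<and> w < n \<and> E u w}"
      using w E[of "par w" w] by (auto simp: e_def min_def max_def)
  qed
  moreover have "card (e ` ({..<n} - {r})) = n - 1" using r by (simp add: card_image[OF inj])
  moreover have "finite {(u,w). u < w \<and> w < n \<and> E u w}"
    by (rule finite_subset[of _ "{..<n} \<times> {..<n}"]) auto
  ultimately have edges: "{(u,w). u < w \<and> w < n \<and> E u w} = e ` ({..<n} - {r})"
    using card by (metis card_subset_eq)
  have sorted: "w \<noteq> r \<and> u = par w \<or> u \<noteq> r \<and> w = par u" if "E u w" "u < w" for u w
  proof -
    have "(u,w) \<in> e ` ({..<n} - {r})" using edges that E[OF that(1)] by blast
    then show ?thesis by (auto simp: e_def min_def max_def split: if_splits)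
  qed
  have "w \<noteq> r \<and> u = par w \<or> u \<noteq> r \<and> w = par u" if "E u w" for u w
    using sorted[of u w] sorted[of w u] E[OF that] that by (metis linorder_neqE_nat)
  then show thesis using par that by blast
qed

text \<open>The degree bound enters once: a neighbour of the root with two children would have
  degree at least three. Thus \<open>par\<close> is injective on the vertices at distance two, and
  \<open>ch\<close> is its inverse.\<close>

lemma two_star_star_graph:
  assumes "two_star n E r"
  obtains ns W ch where "star_graph n E r ns W ch"
proof -
  have E: "\<And>u w. E u w \<Longrightarrow> u < n \<and> w < n \<and> u \<noteq> w \<and> E w u" and r: "r < n"
    and deg: "\<And>w. w < n \<Longrightarrow> w \<noteq> r \<Longrightarrow> card {u. u < n \<and> E w u} \<le> 2"
    using assms unfolding two_star_def by blast+
  obtain par where edges: "\<And>u w. E u w \<Longrightarrow> w \<noteq> r \<and> u = par w \<or> u \<noteq> r \<and> w = par u"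
    and par: "\<And>w. w < n \<Longrightarrow> w \<noteq> r \<Longrightarrow> E (par w) w \<and> (par w = r \<or> E r (par w) \<and> \<not> E r w)"
    by (rule two_star_parent[OF assms]) (rule that; blast)
  define N where "N = {a. E r a}"
  define M where "M = {..<n} - insert r N"
  have N: "a \<in> N \<Longrightarrow> a < n \<and> a \<noteq> r" for a using E by (auto simp: N_def)
  have finN: "finite N" by (rule finite_subset[of _ "{..<n}"]) (use N in auto)
  have parM: "par w \<in> N \<and> E (par w) w \<and> par w \<noteq> r" if "w \<in> M" for w
    using par[of w] that E by (auto simp: M_def N_def)
  have inj: "inj_on par M"
  proof
    fix x y assume xy: "x \<in> M" "y \<in> M" "par x = par y"
    show "x = y"
    proof (rule ccontr)
      assume "x \<noteq> y"
      then have "card {r, x, y} = 3" using xy by (auto simp: M_def)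
      moreover have "{r, x, y} \<subseteq> {u. u < n \<and> E (par x) u}"
        using parM[OF xy(1)] parM[OF xy(2)] xy E r by (auto simp: N_def)
      then have "card {r, x, y} \<le> card {u. u < n \<and> E (par x) u}" by (intro card_mono) auto
      ultimately show False using deg[of "par x"] N[of "par x"] parM[OF xy(1)] by auto
    qed
  qed
  define W where "W = par ` M"
  define ch where "ch = inv_into M par"
  define ns where "ns = sorted_list_of_set N"
  have ch_par: "ch (par w) = w" if "w \<in> M" for w using inv_into_f_f[OF inj that] by (simp add: ch_def)
  have chW: "ch ` W = M" by (force simp: W_def ch_par image_iff)
  have set_ns: "set ns = N" using finN by (simp add: ns_def)
  have dist: "distinct ns" by (simp add: ns_def)
  have W_N: "W \<subseteq> N" using parM by (auto simp: W_def)
  have agents: "{..<n} = insert r (N \<union> M)" using r N by (auto simp: M_def)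
  have "card (insert r (N \<union> M)) = Suc (card N + card M)"
    using finN N by (subst card_insert_disjoint) (auto simp: M_def intro!: card_Un_disjoint)
  then have n: "n = Suc (card N + card M)" using agents by (metis card_lessThan)
  have "(\<Sum>a\<leftarrow>ns. if a \<in> W then 2 else 1) = (\<Sum>a\<in>N. if a \<in> W then 2 else 1 :: nat)"
    by (simp add: sum_list_distinct_conv_sum_set[OF dist] set_ns)
  also have "\<dots> = (\<Sum>a\<in>N. 1 + (if a \<in> W then 1 else 0))" by (intro sum.cong) auto
  also have "\<dots> = card N + card (N \<inter> W)" unfolding sum.distrib using finN by (simp add: sum.If_cases)
  also have "N \<inter> W = W" using W_N by blast
  also have "card W = card M" by (simp add: W_def card_image[OF inj])
  finally have size: "n = Suc (\<Sum>a\<leftarrow>ns. if a \<in> W then 2 else 1)" using n by simp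
  have half: "u = r \<and> w \<in> N \<or> u \<in> W \<and> w = ch u" if "E u w" "w \<noteq> r" "u = par w" for u w
  proof (cases "w \<in> N")
    case True
    then show ?thesis using par[of w] E[OF that(1)] that by (auto simp: N_def)
  next
    case False
    then have "w \<in> M" using that E[OF that(1)] by (auto simp: M_def)
    then show ?thesis using that ch_par by (auto simp: W_def)
  qed
  have edge_cases: "u = r \<and> w \<in> N \<or> w = r \<and> u \<in> N \<or> u \<in> W \<and> w = ch u \<or> w \<in> W \<and> u = ch w"
    if "E u w" for u w
    using edges[OF that] half[of u w] half[of w u] that E[OF that] by blast
  have "star_graph n E r ns W ch"
  proof
    show "inj_on ch W" unfolding W_def by (auto intro!: inj_onI simp: ch_par)
    show "ch ` W \<inter> insert r (set ns) = {}" unfolding chW set_ns by (auto simp: M_def)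
    show "{..<n} = insert r (set ns \<union> ch ` W)" unfolding chW set_ns by (rule agents)
  qed (use r dist set_ns N W_N size edge_cases in auto)
  then show thesis by (rule that)
qed

theorem theorem4:
  shows "\<exists>C::nat. \<forall>n E r. 1 \<le> n \<longrightarrow> two_star n E r \<longrightarrow>
           (\<exists>P. \<forall>v. valuation_profile n v \<longrightarrow>
                 rw_solves n v (locally_envy_free n E v) P (C * n^2) (C * n^3))"
proof (intro exI[of _ 5] allI impI)
  fix n E r assume "1 \<le> n" and star: "two_star n E r"
  obtain ns W ch where "star_graph n E r ns W ch" using two_star_star_graph[OF star] .
  then interpret star_graph n E r ns W ch .
  show "\<exists>P. \<forall>v. valuation_profile n v \<longrightarrow>
      rw_solves n v (locally_envy_free n E v) P (5 * n^2) (5 * n^3)"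
  \<comment> \<open>\<open>win\<close> needs a representative profile. If there is none, the claim
    is vacuous; otherwise any will do, since values at 0 and 1 are the same for all
    valuations.\<close>
  proof (cases "\<exists>v. valuation_profile n v")
    case True
    then obtain v where v: "valuation_profile n v" ..
    from win_initial[OF v] obtain P where P: "\<And>v'. valuation_profile n v' \<Longrightarrow> agree {0,1} v v' \<Longrightarrow>
        rw_solves n v' (locally_envy_free n E v') P (5 * n\<^sup>2) (n * (5 * n\<^sup>2))"
      unfolding win_def by blast
    have "agree {0,1} v v'" if v': "valuation_profile n v'" for v'
    proof -
      have "u 0 0 = 0 \<and> u 0 1 = 1" if "valuation u" for u
      proof
        show "u 0 0 = 0" using additive_refl[OF valuation_additive[OF that]] by simp
        show "u 0 1 = 1" using that unfolding valuation_def by blast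
      qed
      from this[of "v i" for i] this[of "v' i" for i] show ?thesis
        using v v' by (auto simp: agree_def valuation_profile_def)
    qed
    moreover have "n * (5 * n\<^sup>2) = 5 * n ^ 3" by (simp add: power2_eq_square power3_eq_cube)
    ultimately have "rw_solves n v' (locally_envy_free n E v') P (5 * n\<^sup>2) (5 * n ^ 3)"
      if "valuation_profile n v'" for v'
      using P[OF that] that by metis
    then show ?thesis by blast
  qed blast
qed

end
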